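(* For each partition $\alpha$ of $n$ all of whose parts are odd, let $\alpha_1\ge\dots\ge\alpha_s\ge 3$ be its parts different from $1$ and set $C_n^\alpha=\sum \tau_{i^{(1)}_1\dots i^{(1)}_{\alpha_1}}\tau_{i^{(2)}_1\dots i^{(2)}_{\alpha_2}}\cdots\tau_{i^{(s)}_1\dots i^{(s)}_{\alpha_s}}$, the sum over all families of pairwise distinct indices $i^{(r)}_j\in\{1,\dots,n\}$ (with $C_n^\alpha=1$ if $s=0$). Then the elements $C_n^\alpha$, $\alpha$ ranging over the partitions of $n$ into odd parts, form a basis of the supercenter $SZ(\mathfrak A_n)$.
   Context: $\mathfrak A_n$ is the $\mathbb C$-algebra generated by $\tau_1,\dots,\tau_{n-1}$ with relations $\tau_k^2=1$, $(\tau_k\tau_{k+1})^3=1$, $(\tau_k\tau_l)^2=-1$ for $|k-l|>1$; it is $\mathbb Z_2$-graded with all $\tau_k$ odd (it is the quotient of the group algebra of Schur's double cover of $S_n$ by the relation central element $=-1$). Define $\tau_{i,i+1}=\tau_i$, $\tau_{ij}=-\tau_{i,j-1}\tau_{j-1}\tau_{i,j-1}$ for $i<j-1$, and $\tau_{ji}=-\tau_{ij}$; all $\tau_{ij}$ are odd. For pairwise distinct $i_1,\dots,i_p$, $\tau_{i_1i_2\dots i_p}=\tau_{i_1i_2}\tau_{i_2i_3}\cdots\tau_{i_{p-1}i_p}$. The supercenter $SZ(A)$ of a graded algebra is the span of homogeneous $a$ with $ab=(-1)^{p(a)p(b)}ba$ for all homogeneous $b\in A$. *)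

theory Defs
  imports Complex_Main
begin

text \<open>The free associative C-algebra on letters (generators) is modelled by
  functions from words (nat lists) to complex coefficients; the polynomials
  (finite support) over letters 1..n-1 form the free algebra F_n on
  tau_1..tau_(n-1).  The algebra A_n is F_n modulo the two-sided ideal
  generated by the defining relations; we work with representatives in F_n.\<close>

type_synonym fa = "nat list \<Rightarrow> complex"

definition fword :: "nat list \<Rightarrow> fa" where
  "fword u = (\<lambda>w. if w = u then 1 else 0)"

definition fadd :: "fa \<Rightarrow> fa \<Rightarrow> fa" where
  "fadd f g = (\<lambda>w. f w + g w)"

definition fdiff :: "fa \<Rightarrow> fa \<Rightarrow> fa" where
  "fdiff f g = (\<lambda>w. f w - g w)"

definition fscale :: "complex \<Rightarrow> fa \<Rightarrow> fa" where
  "fscale c f = (\<lambda>w. c * f w)"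

definition fneg :: "fa \<Rightarrow> fa" where
  "fneg f = (\<lambda>w. - f w)"

definition fsum :: "('i \<Rightarrow> fa) \<Rightarrow> 'i set \<Rightarrow> fa" where
  "fsum F S = (\<lambda>w. \<Sum>i\<in>S. F i w)"

definition fmul :: "fa \<Rightarrow> fa \<Rightarrow> fa" where
  "fmul f g = (\<lambda>w. \<Sum>k\<le>length w. f (take k w) * g (drop k w))"

definition fprod_list :: "fa list \<Rightarrow> fa" where
  "fprod_list xs = foldr fmul xs (fword [])"

definition is_poly :: "nat \<Rightarrow> fa \<Rightarrow> bool" where
  "is_poly n f \<longleftrightarrow> finite {w. f w \<noteq> 0} \<and> (\<forall>w. f w \<noteq> 0 \<longrightarrow> set w \<subseteq> {1..<n})"

definition rels :: "nat \<Rightarrow> fa set" where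
  "rels n =
     {fdiff (fword [k, k]) (fword []) | k. 1 \<le> k \<and> k < n}
   \<union> {fdiff (fword [k, k+1, k, k+1, k, k+1]) (fword []) | k. 1 \<le> k \<and> k + 1 < n}
   \<union> {fadd (fword [k, l, k, l]) (fword []) | k l.
        1 \<le> k \<and> k < n \<and> 1 \<le> l \<and> l < n \<and> (k + 1 < l \<or> l + 1 < k)}"

inductive_set rel_ideal :: "nat \<Rightarrow> fa set" for n :: nat where
  zero: "(\<lambda>w. 0) \<in> rel_ideal n"
| add: "x \<in> rel_ideal n \<Longrightarrow> y \<in> rel_ideal n \<Longrightarrow> fadd x y \<in> rel_ideal n"
| scale: "x \<in> rel_ideal n \<Longrightarrow> fscale c x \<in> rel_ideal n"
| gen: "r \<in> rels n \<Longrightarrow> set u \<subseteq> {1..<n} \<Longrightarrow> set v \<subseteq> {1..<n} \<Longrightarrow>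
         fmul (fmul (fword u) r) (fword v) \<in> rel_ideal n"

text \<open>Z2-grading: all tau_k odd, so parity of a word is parity of its length.
  The parity is a bool (True = odd).\<close>
definition is_hom :: "bool \<Rightarrow> fa \<Rightarrow> bool" where
  "is_hom p f \<longleftrightarrow> (\<forall>w. f w \<noteq> 0 \<longrightarrow> odd (length w) = p)"

definition ssign :: "bool \<Rightarrow> bool \<Rightarrow> complex" where
  "ssign p q = (if p \<and> q then -1 else 1)"

text \<open>Representatives (chosen homogeneous) of homogeneous supercentral elements of A_n.\<close>
definition supercentral_hom :: "nat \<Rightarrow> fa \<Rightarrow> bool" where
  "supercentral_hom n a \<longleftrightarrow> is_poly n a \<and>
     (\<exists>p. is_hom p a \<and>
        (\<forall>b q. is_poly n b \<and> is_hom q b \<longrightarrow>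
           fdiff (fmul a b) (fscale (ssign p q) (fmul b a)) \<in> rel_ideal n))"

inductive_set szspan :: "nat \<Rightarrow> fa set" for n :: nat where
  base: "supercentral_hom n a \<Longrightarrow> a \<in> szspan n"
| zero: "(\<lambda>w. 0) \<in> szspan n"
| add: "x \<in> szspan n \<Longrightarrow> y \<in> szspan n \<Longrightarrow> fadd x y \<in> szspan n"
| scale: "x \<in> szspan n \<Longrightarrow> fscale c x \<in> szspan n"

definition supercenter_pre :: "nat \<Rightarrow> fa set" where
  "supercenter_pre n = {x. is_poly n x \<and> (\<exists>y\<in>szspan n. fdiff x y \<in> rel_ideal n)}"

text \<open>tt i d = tau_{i, i+d+1}.\<close>
fun tt :: "nat \<Rightarrow> nat \<Rightarrow> fa" where
  "tt i 0 = fword [i]"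
| "tt i (Suc d) = fneg (fmul (fmul (tt i d) (fword [i + d + 1])) (tt i d))"

definition tau :: "nat \<Rightarrow> nat \<Rightarrow> fa" where
  "tau i j = (if i < j then tt i (j - i - 1)
              else if j < i then fneg (tt j (i - j - 1)) else (\<lambda>w. 0))"

fun tcyc :: "nat list \<Rightarrow> fa" where
  "tcyc (a # b # rest) = fmul (tau a b) (tcyc (b # rest))"
| "tcyc _ = fword []"

fun blocks :: "nat list \<Rightarrow> 'a list \<Rightarrow> 'a list list" where
  "blocks [] xs = []"
| "blocks (k # ks) xs = take k xs # blocks ks (drop k xs)"

definition odd_partitions :: "nat \<Rightarrow> nat list set" where
  "odd_partitions n = {\<alpha>. sorted_wrt (\<lambda>x y. x \<ge> y) \<alpha> \<and> (\<forall>a\<in>set \<alpha>. odd a) \<and> sum_list \<alpha> = n}"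

definition Cel :: "nat \<Rightarrow> nat list \<Rightarrow> fa" where
  "Cel n \<alpha> = (let \<beta> = filter (\<lambda>a. a \<noteq> 1) \<alpha> in
     fsum (\<lambda>xs. fprod_list (map tcyc (blocks \<beta> xs)))
          {xs. length xs = sum_list \<beta> \<and> distinct xs \<and> set xs \<subseteq> {1..n}})"

end

theory Submission
  imports Defs "HOL-Combinatorics.Combinatorics"
begin

text \<open>
  Let the generator k act by the operator (C k - C (k + 1)) / sqrt 2 times the transposition (k, k + 1),
  where the C i are Clifford generators commuting with the permutations.  Evaluating words in this
  representation is faithful: the Coxeter relations reduce words with equal permutation to each
  other up to sign, and operators belonging to different permutations are linearly independent.
  In the representation tau i j becomes (C i - C j) / sqrt 2 times the transposition (i, j), so every
  word is, up to sign, a product of tau-cycles along the cycles of its permutation.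

  A supercentral element is fixed by twisted conjugation, hence equals its average over the symmetric
  group.  The average of a product of disjoint cycles vanishes as soon as one of them has even length
  (conjugation by that cycle reverses the sign) and is a multiple of some C^alpha otherwise.
  The Clifford vacuum expectation of a product of disjoint odd cycles depends on the lengths only
  and is nonzero, so the summands of C^alpha with equal permutation cannot cancel; this
  gives linear independence.
\<close>

section \<open>A Clifford algebra tensored with permutations\<close>

text \<open>An equation in the algebra is a membership in \<open>rel_ideal n\<close>. The relations
  bound the algebra by n! words up to sign, but they do not show by themselves that no word equals
  its own negative and so vanishes; that is what the concrete model is for. Permutations may commute
  with the Clifford generators there, because conjugation by C i - C j already swaps the indices; 1
  / sqrt 2 appears because (C i - C j)^2 = 2. Conjugation by a generator renames the indices of a
  \<open>tauop\<close> only up to the sign -1. In a product of an even number of factors these signs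
  disappear, and this is what distinguishes cycles of odd length. An odd permutation has a cycle of
  even length, so the averages of odd words vanish and no odd supercentral class other than 0
  exists. The sign between two words with the same permutation is never computed: it is
  existentially quantified, and it cancels in conjugation, where a word and its inverse both carry
  it.\<close>

type_synonym vec = "nat set \<times> (nat \<Rightarrow> nat) \<Rightarrow> complex"

text \<open>Packing linear endomorphisms into a type makes them an instance of
  \<open>ring_1\<close>, so ring simplification applies to products of operators. One space serves
  all n.\<close>

typedef lin = "{f :: vec \<Rightarrow> vec. (\<forall>F G. f (\<lambda>x. F x + G x) = (\<lambda>x. f F x + f G x))
    \<and> (\<forall>c F. f (\<lambda>x. c * F x) = (\<lambda>x. c * f F x))}"
  morphisms ap Lin
  by (rule exI[of _ "\<lambda>F. F"]) simp

setup_lifting type_definition_lin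

lemma lin_eqI: "(\<And>F x. ap X F x = ap Y F x) \<Longrightarrow> X = Y"
  by (metis ap_inject ext)

instantiation lin :: ring_1
begin

lift_definition zero_lin :: lin is "\<lambda>F x. 0" by simp
lift_definition one_lin :: lin is "\<lambda>F. F" by simp
lift_definition plus_lin :: "lin \<Rightarrow> lin \<Rightarrow> lin" is "\<lambda>f g F x. f F x + g F x"
  by (auto simp: algebra_simps)
lift_definition uminus_lin :: "lin \<Rightarrow> lin" is "\<lambda>f F x. - f F x"
  by auto
lift_definition minus_lin :: "lin \<Rightarrow> lin \<Rightarrow> lin" is "\<lambda>f g F x. f F x - g F x"
  by (auto simp: algebra_simps)
lift_definition times_lin :: "lin \<Rightarrow> lin \<Rightarrow> lin" is "\<lambda>f g F. f (g F)"
  by auto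

instance
proof
  show "(0::lin) \<noteq> 1"
  proof
    assume "(0::lin) = 1"
    then have "ap 0 (\<lambda>x. 1) ({}, id) = ap 1 (\<lambda>x. 1) ({}, id)" by simp
    then show False by (simp add: zero_lin.rep_eq one_lin.rep_eq)
  qed
qed (transfer; auto simp: fun_eq_iff algebra_simps)+

end

text \<open>Scalars are central ring elements; \<open>of_c_left_comm\<close> moves them to the front
  of a product.\<close>

lift_definition of_c :: "complex \<Rightarrow> lin" is "\<lambda>c F x. c * F x"
  by (auto simp: algebra_simps)

lemma of_c_0 [simp]: "of_c 0 = 0" by transfer simp
lemma of_c_1 [simp]: "of_c 1 = 1" by transfer simp
lemma of_c_add: "of_c (a + b) = of_c a + of_c b" by transfer (auto simp: algebra_simps)
lemma of_c_mult: "of_c (a * b) = of_c a * of_c b" by transfer (auto simp: algebra_simps)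
lemma of_c_minus [simp]: "of_c (- a) = - of_c a" by transfer auto
lemma of_c_comm: "X * of_c a = of_c a * X" by transfer auto
lemma of_c_left_comm: "X * (of_c a * Y) = of_c a * (X * Y)"
  by (metis of_c_comm mult.assoc)
lemma of_c_sum: "of_c (sum f A) = (\<Sum>x\<in>A. of_c (f x))"
  by (induction A rule: infinite_finite_induct) (auto simp: of_c_add)
lemma of_c_numeral: "of_c (numeral k) = numeral k"
proof -
  have "of_c (of_nat m) = of_nat m" for m by (induction m) (auto simp: of_c_add)
  from this[of "numeral k"] show ?thesis by simp
qed

lemma ap_of_c [simp]: "ap (of_c c) F x = c * F x" by (simp add: of_c.rep_eq)
lemma ap_mult [simp]: "ap (X * Y) F = ap X (ap Y F)" by (simp add: times_lin.rep_eq)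
lemma ap_plus [simp]: "ap (X + Y) F x = ap X F x + ap Y F x" by (simp add: plus_lin.rep_eq)
lemma ap_minus [simp]: "ap (X - Y) F x = ap X F x - ap Y F x" by (simp add: minus_lin.rep_eq)
lemma ap_uminus [simp]: "ap (- X) F x = - ap X F x" by (simp add: uminus_lin.rep_eq)
lemma ap_one [simp]: "ap 1 F = F" by (simp add: one_lin.rep_eq)
lemma ap_zero [simp]: "ap 0 F x = 0" by (simp add: zero_lin.rep_eq)
lemma ap_sum: "ap (sum f A) F x = (\<Sum>i\<in>A. ap (f i) F x)"
  by (induction A rule: infinite_finite_induct) auto

text \<open>Jordan-Wigner signs for the action of the Clifford generators on subsets.\<close>
definition sg :: "nat \<Rightarrow> nat set \<Rightarrow> complex" where
  "sg i S = (\<Prod>l<i. if l \<in> S then -1 else 1)"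

definition flip :: "nat \<Rightarrow> nat set \<Rightarrow> nat set" where
  "flip i S = (if i \<in> S then S - {i} else insert i S)"

text \<open>The sign \<open>sg j\<close> reads only positions below j. This asymmetry between i < j
  and j < i is the source of the anticommutation of the \<open>C i\<close>.\<close>

lemma sg_flip: "sg j (flip i S) = (if i < j then - sg j S else sg j S)"
proof (cases "i < j")
  case True
  have eq: "(\<Prod>l\<in>{..<j} - {i}. if l \<in> flip i S then - 1 else 1::complex)
     = (\<Prod>l\<in>{..<j} - {i}. if l \<in> S then - 1 else 1)"
    by (rule prod.cong) (auto simp: flip_def)
  show ?thesis
    using True unfolding sg_def
    by (simp add: prod.remove[of "{..<j}" i] eq) (auto simp: flip_def)
next
  case False
  then show ?thesis unfolding sg_def
    by simp (rule prod.cong, auto simp: flip_def)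
qed

lemma sg_sq: "sg i S * sg i S = 1"
proof -
  have "sg i S * sg i S = (\<Prod>l<i. (if l \<in> S then -1 else 1) * (if l \<in> S then -1 else 1))"
    unfolding sg_def by (rule prod.distrib[symmetric])
  also have "\<dots> = 1" by (rule prod.neutral) auto
  finally show ?thesis .
qed

lemma flip_flip [simp]: "flip i (flip i S) = S"
  by (auto simp: flip_def)

lemma flip_commute: "flip i (flip j S) = flip j (flip i S)"
  by (auto simp: flip_def)

lift_definition C :: "nat \<Rightarrow> lin" is "\<lambda>i F (S, p). sg i S * F (flip i S, p)"
  by (auto simp: fun_eq_iff algebra_simps)

text \<open>Translation of the argument from the right makes \<open>P\<close> multiplicative in the
  given order. The subset component is left alone, hence \<open>P_C\<close>.\<close>

lift_definition P :: "(nat \<Rightarrow> nat) \<Rightarrow> lin" is "\<lambda>q F (S, p). F (S, p \<circ> q)"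
  by (auto simp: fun_eq_iff)

lemma ap_C [simp]: "ap (C i) F (S, p) = sg i S * F (flip i S, p)" by (simp add: C.rep_eq)
lemma ap_P [simp]: "ap (P q) F (S, p) = F (S, p \<circ> q)" by (simp add: P.rep_eq)

lemma C_sq [simp]: "C i * C i = 1"
proof (rule lin_eqI)
  fix F x show "ap (C i * C i) F x = ap 1 F x"
    using sg_sq[of i "fst x"] by (cases x) (simp add: sg_flip mult.assoc[symmetric])
qed

lemma C_anti: "i \<noteq> j \<Longrightarrow> C i * C j = - (C j * C i)"
proof (rule lin_eqI)
  fix F x assume "i \<noteq> j" then show "ap (C i * C j) F x = ap (- (C j * C i)) F x"
    by (cases x) (cases "i < j"; simp add: sg_flip flip_commute[of i j])
qed

lemma P_mult: "P q * P r = P (q \<circ> r)"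
  by (rule lin_eqI) (auto simp: comp_assoc)

lemma P_id [simp]: "P id = 1"
  by (rule lin_eqI) auto

lemma P_C: "P q * C i = C i * P q"
  by (rule lin_eqI) auto

lemma C_sq_left [simp]: "C i * (C i * X) = X"
  by (metis C_sq mult.assoc mult_1_left)

section \<open>Reflections and the operators of the tau elements\<close>

definition V :: "nat \<Rightarrow> nat \<Rightarrow> lin" where "V i j = C i - C j"

lemma P_V: "P q * V i j = V i j * P q"
  by (simp add: V_def algebra_simps P_C)

definition h :: lin where "h = of_c (complex_of_real (1 / sqrt 2))"

lemma h_left_comm: "X * (h * Y) = h * (X * Y)" by (simp add: h_def of_c_left_comm)
lemma h_sq2: "2 * (h * h) = 1"
proof -
  have "2 * (h * h) = of_c (complex_of_real (2 * (1 / sqrt 2 * (1 / sqrt 2))))"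
    by (simp only: h_def of_c_mult of_c_numeral of_real_mult of_real_numeral)
  also have "2 * (1 / sqrt 2 * (1 / sqrt 2)) = 1"
    by simp
  finally show ?thesis by simp
qed

definition tauop :: "nat \<Rightarrow> nat \<Rightarrow> lin" where
  "tauop i j = h * V i j * P (transpose i j)"

lemma tauop_swap: "tauop j i = - tauop i j"
  by (simp add: tauop_def V_def transpose_commute algebra_simps)

lemma P_h_left: "P q * (h * X) = h * (P q * X)"
  and V_h_left: "V i j * (h * X) = h * (V i j * X)"
  by (rule h_left_comm)+

lemma P_V_left: "P q * (V i j * X) = V i j * (P q * X)"
  by (metis P_V mult.assoc)

lemmas hVP_simps = mult.assoc P_h_left V_h_left P_V P_V_left P_mult

lemma V_sq: "i \<noteq> j \<Longrightarrow> V i j * V i j = 2"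
  using C_anti[of i j] by (simp add: V_def algebra_simps)

lemma tauop_sq: "i \<noteq> j \<Longrightarrow> tauop i j * tauop i j = 1"
proof -
  assume "i \<noteq> j"
  have "tauop i j * tauop i j = h * (h * (V i j * V i j)) * P (transpose i j \<circ> transpose i j)"
    by (simp add: tauop_def hVP_simps)
  also have "\<dots> = h * (h * 2)" using V_sq[OF \<open>i \<noteq> j\<close>] by simp
  also have "\<dots> = 1" using h_sq2 by (simp add: mult_2 mult_2_right distrib_left)
  finally show ?thesis .
qed

text \<open>Conjugation by a unit vector of a Clifford algebra is minus the reflection in its
  orthogonal hyperplane. For the direction C k - C l this reflection exchanges k and l; the factor 2
  is the square of \<open>V k l\<close>.\<close>

lemma V_reflect:
  assumes "k \<noteq> l"
  shows "V k l * C i * V k l = - (2 * C (transpose k l i))"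
proof -
  have anti: "C a * (C b * X) = - (C b * (C a * X))" if "a \<noteq> b" for a b X
    using C_anti[OF that] by (metis mult.assoc mult_minus_left)
  consider "i = k" | "i = l" | "i \<noteq> k" "i \<noteq> l" by blast
  then show ?thesis
  proof cases
    case 1
    then show ?thesis using assms by (simp add: V_def algebra_simps anti C_anti[of l k] mult_2)
  next
    case 2
    then show ?thesis using assms by (simp add: V_def algebra_simps anti C_anti[of l k] mult_2)
  next
    case 3
    then show ?thesis using assms
      by (simp add: V_def algebra_simps anti[of i k] anti[of i l] anti[of l k] C_anti[of i k] C_anti[of i l] C_anti[of l k] transpose_def mult_2)
  qed
qed

text \<open>The Clifford part and the permutation part are renamed alike, and the 2 of
  \<open>V_reflect\<close> is absorbed by h * h. The recursion for tau_ij, the braid relation and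
  the anticommutation of disjoint transpositions are all instances.\<close>

lemma tauop_conj:
  assumes "k \<noteq> l" "i \<noteq> j"
  shows "tauop k l * tauop i j * tauop k l = - tauop (transpose k l i) (transpose k l j)"
proof -
  let ?s = "transpose k l"
  have p: "?s \<circ> transpose i j \<circ> ?s = transpose (?s i) (?s j)"
    by (rule ext) (auto simp: transpose_def)
  have v: "V k l * V i j * V k l = - (2 * V (?s i) (?s j))"
    using V_reflect[OF assms(1), of i] V_reflect[OF assms(1), of j]
    by (simp add: V_def[of i j] V_def[of "?s i"] algebra_simps)
  have "tauop k l * tauop i j * tauop k l
     = h * (h * (h * (V k l * V i j * V k l))) * P (?s \<circ> transpose i j \<circ> ?s)"
    by (simp add: tauop_def hVP_simps comp_assoc)
  also have "\<dots> = - (h * (2 * (h * h)) * V (?s i) (?s j) * P (transpose (?s i) (?s j)))"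
    unfolding v p by (simp add: mult_2 algebra_simps)
  finally show ?thesis by (simp add: h_sq2 tauop_def)
qed

lemma tauop_anti:
  assumes "distinct [i, j, k, l]"
  shows "tauop i j * tauop k l = - (tauop k l * tauop i j)"
proof -
  \<comment> \<open>The transposition (i, j) fixes k and l, so only the sign of
    \<open>tauop_conj\<close> remains.\<close>
  have "tauop i j * tauop k l * tauop i j = - tauop k l"
    using tauop_conj[of i j k l] assms by (auto simp: transpose_def)
  then have "tauop i j * tauop k l * tauop i j * tauop i j = - tauop k l * tauop i j" by simp
  then show ?thesis using tauop_sq[of i j] assms by (simp add: mult.assoc)
qed

section \<open>Supports\<close>

lemma fmul_nonzero:
  assumes "fmul f g w \<noteq> 0"
  obtains u v where "w = u @ v" "f u \<noteq> 0" "g v \<noteq> 0"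
proof -
  from assms obtain k where "f (take k w) * g (drop k w) \<noteq> 0"
    unfolding fmul_def by (metis (no_types, lifting) sum.not_neutral_contains_not_neutral)
  then show ?thesis using that[of "take k w" "drop k w"] by auto
qed

lemma is_poly_fword: "set u \<subseteq> {1..<n} \<Longrightarrow> is_poly n (fword u)"
  by (auto simp: is_poly_def fword_def)

lemma is_poly_zero: "is_poly n (\<lambda>w. 0)"
  by (simp add: is_poly_def)

lemma is_poly_fadd:
  assumes "is_poly n f" "is_poly n g"
  shows "is_poly n (fadd f g)"
proof -
  have sub: "{w. fadd f g w \<noteq> 0} \<subseteq> {w. f w \<noteq> 0} \<union> {w. g w \<noteq> 0}"
    by (auto simp: fadd_def)
  then have "finite {w. fadd f g w \<noteq> 0}"
    by (rule finite_subset) (use assms in \<open>simp add: is_poly_def\<close>)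
  then show ?thesis using sub assms unfolding is_poly_def by blast
qed

lemma is_poly_fscale: "is_poly n f \<Longrightarrow> is_poly n (fscale c f)"
  unfolding is_poly_def fscale_def
  by (auto intro: finite_subset[of _ "{w. f w \<noteq> 0}"])

lemma fneg_eq: "fneg f = fscale (-1) f"
  by (simp add: fneg_def fscale_def)

lemma fdiff_eq: "fdiff f g = fadd f (fscale (-1) g)"
  by (simp add: fdiff_def fadd_def fscale_def)

lemma is_poly_fneg: "is_poly n f \<Longrightarrow> is_poly n (fneg f)"
  by (simp add: fneg_eq is_poly_fscale)

lemma is_poly_fdiff: "is_poly n f \<Longrightarrow> is_poly n g \<Longrightarrow> is_poly n (fdiff f g)"
  by (simp add: fdiff_eq is_poly_fscale is_poly_fadd)

lemma is_poly_fmul: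
  assumes "is_poly n f" "is_poly n g"
  shows "is_poly n (fmul f g)"
proof -
  have "{w. fmul f g w \<noteq> 0} \<subseteq> (\<lambda>(u, v). u @ v) ` ({u. f u \<noteq> 0} \<times> {v. g v \<noteq> 0})"
    by (auto elim!: fmul_nonzero)
  moreover have "finite \<dots>" using assms by (simp add: is_poly_def)
  ultimately have "finite {w. fmul f g w \<noteq> 0}" by (rule finite_subset)
  moreover have "set w \<subseteq> {1..<n}" if "fmul f g w \<noteq> 0" for w
    using that assms unfolding is_poly_def by (elim fmul_nonzero) (metis le_sup_iff set_append)
  ultimately show ?thesis by (simp add: is_poly_def)
qed

lemma fsum_empty: "fsum F {} = (\<lambda>w. 0)"
  by (simp add: fsum_def)

lemma fsum_insert: "finite S \<Longrightarrow> i \<notin> S \<Longrightarrow> fsum F (insert i S) = fadd (F i) (fsum F S)"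
  by (simp add: fsum_def fadd_def)

lemma fsum_infinite: "infinite S \<Longrightarrow> fsum F S = (\<lambda>w. 0)"
  by (simp add: fsum_def)

lemma is_poly_fsum: "(\<And>i. i \<in> S \<Longrightarrow> is_poly n (F i)) \<Longrightarrow> is_poly n (fsum F S)"
  by (induction S rule: infinite_finite_induct)
     (simp_all add: fsum_empty fsum_insert fsum_infinite is_poly_zero is_poly_fadd)

lemma is_poly_fprod_list: "(\<And>f. f \<in> set fs \<Longrightarrow> is_poly n f) \<Longrightarrow> is_poly n (fprod_list fs)"
  by (induction fs) (simp_all add: fprod_list_def is_poly_fword is_poly_fmul)

lemma fmul_fadd_left: "fmul (fadd f g) k = fadd (fmul f k) (fmul g k)"
  and fmul_fadd_right: "fmul k (fadd f g) = fadd (fmul k f) (fmul k g)"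
  by (simp_all add: fmul_def fadd_def sum.distrib algebra_simps)

lemma fmul_fscale_left: "fmul (fscale c f) g = fscale c (fmul f g)"
  and fmul_fscale_right: "fmul f (fscale c g) = fscale c (fmul f g)"
  by (simp_all add: fmul_def fscale_def sum_distrib_left algebra_simps)

lemma fmul_fword: "fmul (fword u) (fword v) = fword (u @ v)"
proof
  fix w
  have eq: "fword u (take k w) * fword v (drop k w) = (if k = length u \<and> w = u @ v then 1 else 0)"
    if "k \<le> length w" for k
    using that by (auto simp: fword_def)
  show "fmul (fword u) (fword v) w = fword (u @ v) w"
  proof (cases "w = u @ v")
    case True
    then have "fmul (fword u) (fword v) w = (\<Sum>k\<le>length w. if k = length u then 1 else 0)"
      unfolding fmul_def by (intro sum.cong) (use eq in auto)
    then show ?thesis using True by (simp add: fword_def)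
  next
    case False
    then have "fmul (fword u) (fword v) w = 0"
      unfolding fmul_def by (intro sum.neutral) (use eq in auto)
    then show ?thesis using False by (simp add: fword_def)
  qed
qed

section \<open>Evaluation of words\<close>

definition T :: "nat \<Rightarrow> lin" where "T k = tauop k (Suc k)"

definition opw :: "nat list \<Rightarrow> lin" where "opw w = prod_list (map T w)"

definition pm :: "nat list \<Rightarrow> nat \<Rightarrow> nat" where
  "pm w = foldr (\<lambda>k f. transpose k (Suc k) \<circ> f) w id"

lemma opw_simps [simp]: "opw [] = 1" "opw (k # w) = T k * opw w" "opw (u @ v) = opw u * opw v"
  by (simp_all add: opw_def)

lemma opw_of_c_left: "opw u * (of_c a * X) = of_c a * (opw u * X)"
  by (rule of_c_left_comm)

lemma pm_simps [simp]: "pm [] = id" "pm (k # w) = transpose k (Suc k) \<circ> pm w"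
  by (simp_all add: pm_def)

lemma pm_append [simp]: "pm (u @ v) = pm u \<circ> pm v"
  by (induction u) (simp_all add: comp_assoc)

lemma pm_permutes: "set w \<subseteq> {1..<n} \<Longrightarrow> pm w permutes {1..n}"
proof (induction w)
  case (Cons k w)
  then have "transpose k (Suc k) permutes {1..n}"
    by (intro permutes_swap_id) auto
  then show ?case using Cons by (simp only: pm_simps) (rule permutes_compose, auto)
qed (simp only: pm_simps permutes_id)

lemma pm_bij: "bij (pm w)"
  by (induction w) (simp_all only: pm_simps bij_id bij_comp bij_transpose)

lemma T_sq [simp]: "T k * T k = 1" by (simp add: T_def tauop_sq)

lemma T_sq_left [simp]: "T k * (T k * X) = X"
  by (metis T_sq mult.assoc mult_1_left)

lemma opw_rev: "opw (rev w) * opw w = 1" 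
proof (induction w)
  case (Cons k w)
  then show ?case by (simp add: mult.assoc)
qed simp

lemma opw_rev': "opw w * opw (rev w) = 1"
  using opw_rev[of "rev w"] by simp

text \<open>Both sides equal \<open>- tauop k (Suc (Suc k))\<close>.\<close>

lemma T_braid: "T k * T (Suc k) * T k = T (Suc k) * T k * T (Suc k)"
  using tauop_conj[of k "Suc k" "Suc k" "Suc (Suc k)"] tauop_conj[of "Suc k" "Suc (Suc k)" k "Suc k"]
  by (simp add: T_def transpose_def)

lemma T_anti: "Suc k < l \<or> Suc l < k \<Longrightarrow> T k * T l = - (T l * T k)"
  unfolding T_def by (rule tauop_anti) auto

text \<open>On a function of infinite support this sum is 0 by convention, so the algebraic laws
  below are stated for polynomials.\<close>

definition Phi :: "fa \<Rightarrow> lin" where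
  "Phi f = (\<Sum>u | f u \<noteq> 0. of_c (f u) * opw u)"

lemma Phi_superset:
  assumes "finite A" "\<And>w. f w \<noteq> 0 \<Longrightarrow> w \<in> A"
  shows "Phi f = (\<Sum>u\<in>A. of_c (f u) * opw u)"
  unfolding Phi_def by (rule sum.mono_neutral_left) (use assms in auto)

lemma Phi_zero [simp]: "Phi (\<lambda>w. 0) = 0"
  by (simp add: Phi_def)

lemma Phi_fword [simp]: "Phi (fword u) = opw u"
  by (subst Phi_superset[of "{u}"]) (auto simp: fword_def split: if_splits)

lemma Phi_fadd:
  assumes "is_poly n f" "is_poly n g"
  shows "Phi (fadd f g) = Phi f + Phi g"
proof -
  let ?A = "{w. f w \<noteq> 0} \<union> {w. g w \<noteq> 0}"
  have "finite ?A" using assms by (simp add: is_poly_def)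
  then show ?thesis
    by (subst (1 2 3) Phi_superset[of ?A]) (auto simp: fadd_def of_c_add algebra_simps sum.distrib)
qed

lemma Phi_fscale:
  assumes "is_poly n f"
  shows "Phi (fscale c f) = of_c c * Phi f"
proof -
  let ?A = "{w. f w \<noteq> 0}"
  have "finite ?A" using assms by (simp add: is_poly_def)
  then show ?thesis
    by (subst (1 2) Phi_superset[of ?A]) (auto simp: fscale_def of_c_mult mult.assoc sum_distrib_left)
qed

lemma Phi_fneg: "is_poly n f \<Longrightarrow> Phi (fneg f) = - Phi f"
  by (simp add: fneg_eq Phi_fscale)

lemma Phi_fdiff: "is_poly n f \<Longrightarrow> is_poly n g \<Longrightarrow> Phi (fdiff f g) = Phi f - Phi g"
  by (simp add: fdiff_eq Phi_fadd is_poly_fscale Phi_fscale)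

lemma Phi_fsum: "(\<And>i. i \<in> S \<Longrightarrow> is_poly n (F i)) \<Longrightarrow> Phi (fsum F S) = (\<Sum>i\<in>S. Phi (F i))"
  by (induction S rule: infinite_finite_induct)
     (simp_all add: fsum_empty fsum_insert fsum_infinite Phi_fadd[where n = n] is_poly_fsum)

lemma Phi_fmul:
  assumes "is_poly n f" "is_poly n g"
  shows "Phi (fmul f g) = Phi f * Phi g"
proof -
  let ?A = "{w. f w \<noteq> 0}" and ?B = "{w. g w \<noteq> 0}"
  let ?W = "(\<lambda>(u, v). u @ v) ` (?A \<times> ?B)"
  have fin: "finite ?A" "finite ?B" using assms by (simp_all add: is_poly_def)
  \<comment> \<open>Cut positions of w with nonzero contribution correspond to pairs of support
    words whose concatenation is w.\<close>
  have split: "fmul f g w = (\<Sum>(u, v) | (u, v) \<in> ?A \<times> ?B \<and> u @ v = w. f u * g v)" for w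
  proof -
    have "fmul f g w = (\<Sum>k | k \<le> length w \<and> f (take k w) * g (drop k w) \<noteq> 0. f (take k w) * g (drop k w))"
      unfolding fmul_def by (rule sum.mono_neutral_right) auto
    also have "\<dots> = (\<Sum>(u, v) | (u, v) \<in> ?A \<times> ?B \<and> u @ v = w. f u * g v)"
      by (rule sum.reindex_bij_witness[of _ "\<lambda>(u, v). length u" "\<lambda>k. (take k w, drop k w)"]) auto
    finally show ?thesis .
  qed
  have "Phi (fmul f g) = (\<Sum>w\<in>?W. of_c (fmul f g w) * opw w)"
    by (rule Phi_superset) (use fin in \<open>auto elim!: fmul_nonzero\<close>)
  also have "\<dots> = (\<Sum>w\<in>?W. \<Sum>x | x \<in> ?A \<times> ?B \<and> (\<lambda>(u, v). u @ v) x = w.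
       (\<lambda>(u, v). of_c (f u * g v) * opw (u @ v)) x)"
    unfolding split of_c_sum sum_distrib_right
    by (intro sum.cong) (auto simp: case_prod_unfold)
  also have "\<dots> = (\<Sum>(u, v)\<in>?A \<times> ?B. of_c (f u * g v) * opw (u @ v))"
    by (rule sum.group) (use fin in auto)
  also have "\<dots> = (\<Sum>u\<in>?A. \<Sum>v\<in>?B. (of_c (f u) * opw u) * (of_c (g v) * opw v))"
    by (simp add: sum.cartesian_product of_c_mult mult.assoc opw_of_c_left)
  also have "\<dots> = Phi f * Phi g"
    by (simp add: Phi_def sum_product)
  finally show ?thesis .
qed

lemma Phi_fprod_list:
  "(\<And>f. f \<in> set fs \<Longrightarrow> is_poly n f) \<Longrightarrow> Phi (fprod_list fs) = prod_list (map Phi fs)"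
proof (induction fs)
  case (Cons f fs)
  then show ?case
    using Phi_fmul[of n f "fprod_list fs"] by (simp add: is_poly_fprod_list) (simp add: fprod_list_def)
qed (simp add: fprod_list_def)

section \<open>The ideal\<close>

text \<open>All three kinds of relators have the form p - e q with words p, q and a sign e. Later
  arguments need only this form and the matching operator identity.\<close>

lemma rels_cases:
  assumes "r \<in> rels n"
  obtains p q e where "e = 1 \<or> e = (-1::complex)" "r = fdiff (fword p) (fscale e (fword q))"
    "opw p = of_c e * opw q" "set p \<subseteq> {1..<n}" "set q \<subseteq> {1..<n}"
proof -
  from assms consider
      k where "r = fdiff (fword [k, k]) (fword [])" "1 \<le> k" "k < n"
    | k where "r = fdiff (fword [k, k+1, k, k+1, k, k+1]) (fword [])" "1 \<le> k" "k + 1 < n"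
    | k l where "r = fadd (fword [k, l, k, l]) (fword [])" "1 \<le> k" "k < n" "1 \<le> l" "l < n"
        "k + 1 < l \<or> l + 1 < k"
    unfolding rels_def by blast
  then show ?thesis
  proof cases
    case 1
    show ?thesis by (rule that[of 1 "[k, k]" "[]"]) (use 1 in \<open>auto simp: fscale_def\<close>)
  next
    case 2
    have "T k * (T (Suc k) * (T k * (T (Suc k) * (T k * T (Suc k))))) = (T k * T (Suc k) * T k) * (T (Suc k) * T k * T (Suc k))"
      by (simp add: mult.assoc)
    also have "\<dots> = (T (Suc k) * T k * T (Suc k)) * (T (Suc k) * T k * T (Suc k))"
      by (simp only: T_braid)
    also have "\<dots> = 1" by (simp add: mult.assoc)
    finally show ?thesis 
      by (intro that[of 1 "[k, k+1, k, k+1, k, k+1]" "[]"]) (use 2 in \<open>auto simp: fscale_def\<close>)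
  next
    case 3
    have "T k * (T l * (T k * T l)) = - 1"
      using T_anti[of k l] 3 by simp
    then show ?thesis
      by (intro that[of "-1" "[k, l, k, l]" "[]"])
         (use 3 in \<open>auto simp: fdiff_def fadd_def fscale_def\<close>)
  qed
qed

lemma fmul_word_rel:
  "fmul (fmul (fword u) (fdiff (fword p) (fscale e (fword q)))) (fword v)
    = fdiff (fword (u @ p @ v)) (fscale e (fword (u @ q @ v)))"
  by (simp add: fdiff_eq fmul_fadd_left fmul_fadd_right fmul_fscale_left fmul_fscale_right fmul_fword)

lemma rel_ideal_poly_Phi: "x \<in> rel_ideal n \<Longrightarrow> is_poly n x \<and> Phi x = 0"
proof (induction rule: rel_ideal.induct)
  case (gen r u v)
  from gen(1) show ?case
  proof (rule rels_cases)
    fix p q and e :: complex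
    assume r: "r = fdiff (fword p) (fscale e (fword q))" and op: "opw p = of_c e * opw q"
      and sub: "set p \<subseteq> {1..<n}" "set q \<subseteq> {1..<n}"
    have 1: "is_poly n (fword (u @ p @ v))" "is_poly n (fword (u @ q @ v))"
      using sub gen(2,3) by (metis is_poly_fword set_append Un_least)+
    then show ?thesis
      unfolding r fmul_word_rel
      by (simp add: is_poly_fdiff is_poly_fscale Phi_fdiff[of n] Phi_fscale[of n] op mult.assoc opw_of_c_left)
  qed
qed (auto simp: is_poly_zero is_poly_fadd is_poly_fscale Phi_fadd Phi_fscale)

lemma rel_ideal_Phi: "x \<in> rel_ideal n \<Longrightarrow> Phi x = 0"
  using rel_ideal_poly_Phi by blast

lemma rel_ideal_fsum: "(\<And>i. i \<in> S \<Longrightarrow> F i \<in> rel_ideal n) \<Longrightarrow> fsum F S \<in> rel_ideal n"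
  by (induction S rule: infinite_finite_induct)
     (simp_all add: fsum_empty fsum_insert fsum_infinite rel_ideal.zero rel_ideal.add)

text \<open>A generator of the ideal already stands between two words, so a further context is
  absorbed into these.\<close>

lemma rel_ideal_ctx:
  assumes "x \<in> rel_ideal n" "set a \<subseteq> {1..<n}" "set b \<subseteq> {1..<n}"
  shows "fmul (fmul (fword a) x) (fword b) \<in> rel_ideal n"
  using assms(1)
proof (induction rule: rel_ideal.induct)
  case zero
  then show ?case using rel_ideal.zero by (simp add: fmul_def)
next
  case (add x y)
  then show ?case by (simp add: fmul_fadd_left fmul_fadd_right rel_ideal.add)
next
  case (scale x c)
  then show ?case by (simp add: fmul_fscale_left fmul_fscale_right rel_ideal.scale)
next
  case (gen r u v)
  from gen(1) show ?case
  proof (rule rels_cases)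
    fix p q and e :: complex
    assume r: "r = fdiff (fword p) (fscale e (fword q))"
    have "fmul (fmul (fword (a @ u)) r) (fword (v @ b)) \<in> rel_ideal n"
      using gen assms by (intro rel_ideal.gen) auto
    then show ?thesis unfolding r fmul_word_rel by simp
  qed
qed

text \<open>Congruence modulo the relations up to an unspecified sign. The equality of permutations
  is carried along so that two normal forms can be compared through their permutations.\<close>

definition E :: "nat \<Rightarrow> nat list \<Rightarrow> nat list \<Rightarrow> bool" where
  "E n u v \<longleftrightarrow> pm u = pm v \<and> (\<exists>e. (e = 1 \<or> e = -1) \<and> fdiff (fword u) (fscale e (fword v)) \<in> rel_ideal n)"

lemma E_refl [simp]: "E n u u"
  unfolding E_def by (auto intro!: exI[of _ 1] simp: fdiff_def fscale_def rel_ideal.zero)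

lemma E_sym: "E n u v \<Longrightarrow> E n v u"
proof -
  assume "E n u v"
  then obtain e where e: "e = 1 \<or> e = -1" "fdiff (fword u) (fscale e (fword v)) \<in> rel_ideal n" "pm u = pm v"
    by (auto simp: E_def)
  have "fdiff (fword v) (fscale e (fword u)) = fscale (-e) (fdiff (fword u) (fscale e (fword v)))"
    using e(1) by (auto simp: fdiff_def fscale_def)
  then show ?thesis using e unfolding E_def by (metis rel_ideal.scale)
qed

lemma E_trans [trans]: "E n u v \<Longrightarrow> E n v w \<Longrightarrow> E n u w"
proof -
  assume "E n u v" "E n v w"
  then obtain d e where e: "d = 1 \<or> d = -1" "fdiff (fword u) (fscale d (fword v)) \<in> rel_ideal n"
      "e = 1 \<or> e = -1" "fdiff (fword v) (fscale e (fword w)) \<in> rel_ideal n" "pm u = pm w"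
    by (auto simp: E_def)
  have "fdiff (fword u) (fscale (d * e) (fword w))
     = fadd (fdiff (fword u) (fscale d (fword v))) (fscale d (fdiff (fword v) (fscale e (fword w))))"
    by (auto simp: fdiff_def fscale_def fadd_def algebra_simps)
  then have "fdiff (fword u) (fscale (d * e) (fword w)) \<in> rel_ideal n"
    using e by (simp add: rel_ideal.add rel_ideal.scale)
  then show ?thesis using e unfolding E_def by (intro conjI exI[of _ "d * e"]) auto
qed

lemma E_ctx:
  assumes "E n u v" "set a \<subseteq> {1..<n}" "set b \<subseteq> {1..<n}"
  shows "E n (a @ u @ b) (a @ v @ b)"
proof -
  obtain e where e: "e = 1 \<or> e = -1" "fdiff (fword u) (fscale e (fword v)) \<in> rel_ideal n" "pm u = pm v"
    using assms by (auto simp: E_def)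
  have "fdiff (fword (a @ u @ b)) (fscale e (fword (a @ v @ b))) \<in> rel_ideal n"
    using rel_ideal_ctx[OF e(2) assms(2,3)] by (simp add: fmul_word_rel)
  then show ?thesis using e by (auto simp: E_def)
qed

text \<open>\<open>Phi\<close> kills the ideal, so the sign of the congruence is also the sign
  between the operators. Faithfulness relies on the same e in both places.\<close>

lemma E_opw: "E n u v \<Longrightarrow> set v \<subseteq> {1..<n} \<Longrightarrow> set u \<subseteq> {1..<n} \<Longrightarrow>
   \<exists>e. (e = 1 \<or> e = -1) \<and> fdiff (fword u) (fscale e (fword v)) \<in> rel_ideal n \<and> opw u = of_c e * opw v"
proof -
  assume "E n u v" and w: "set v \<subseteq> {1..<n}" "set u \<subseteq> {1..<n}"
  then obtain e where e: "e = 1 \<or> e = -1" "fdiff (fword u) (fscale e (fword v)) \<in> rel_ideal n" "pm u = pm v"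
    by (auto simp: E_def)
  have "opw u = of_c e * opw v"
    using rel_ideal_Phi[OF e(2)] w by (simp add: Phi_fdiff[of n] Phi_fscale[of n] is_poly_fword is_poly_fscale)
  then show ?thesis using e by blast
qed

section \<open>The relations as rewriting rules up to sign\<close>

lemma E_sq: "1 \<le> k \<Longrightarrow> k < n \<Longrightarrow> E n [k, k] []"
proof -
  assume k: "1 \<le> k" "k < n"
  have "fmul (fmul (fword []) (fdiff (fword [k, k]) (fscale 1 (fword [])))) (fword []) \<in> rel_ideal n"
    by (rule rel_ideal.gen) (use k in \<open>auto simp: rels_def fscale_def\<close>)
  then show ?thesis unfolding fmul_word_rel E_def by (auto simp: comp_assoc[symmetric])
qed

lemma E_cancel: "1 \<le> k \<Longrightarrow> k < n \<Longrightarrow> set a \<subseteq> {1..<n} \<Longrightarrow> set b \<subseteq> {1..<n} \<Longrightarrow> E n (a @ [k, k] @ b) (a @ b)"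
  using E_ctx[OF E_sq, of k n a b] by simp

lemma E_commute:
  assumes "1 \<le> k" "k < n" "1 \<le> l" "l < n" "Suc k < l \<or> Suc l < k"
  shows "E n [k, l] [l, k]"
proof -
  have "fmul (fmul (fword []) (fdiff (fword [k, l, k, l]) (fscale (-1) (fword [])))) (fword []) \<in> rel_ideal n"
    by (rule rel_ideal.gen) (use assms in \<open>auto simp: rels_def fscale_def fdiff_def fadd_def\<close>)
  moreover have "pm [k, l, k, l] = pm []"
    using assms by (auto simp: fun_eq_iff transpose_def)
  ultimately have 1: "E n [k, l, k, l] []" 
    unfolding fmul_word_rel E_def by auto
  \<comment> \<open>Inserting k k and then l l completes the relator k l k l at the front; its
    removal leaves l k.\<close>
  have "E n [k, l] ([k, l, k] @ [k])" using E_cancel[of k n "[k, l]" "[]"] assms by (auto intro: E_sym)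
  also have "E n ([k, l, k] @ [k]) ([k, l, k] @ [l, l] @ [k])"
    by (rule E_sym, rule E_cancel) (use assms in auto)
  also have "E n ([k, l, k] @ [l, l] @ [k]) [l, k]"
    using E_ctx[OF 1, of "[]" "[l, k]"] assms by simp
  finally show ?thesis .
qed

lemma E_braid:
  assumes "1 \<le> k" "Suc k < n"
  shows "E n [Suc k, k, Suc k] [k, Suc k, k]"
proof -
  let ?l = "Suc k"
  have "fmul (fmul (fword []) (fdiff (fword [k, k+1, k, k+1, k, k+1]) (fscale 1 (fword [])))) (fword []) \<in> rel_ideal n"
    by (rule rel_ideal.gen) (use assms in \<open>auto simp: rels_def fscale_def\<close>)
  moreover have "pm [k, k+1, k, k+1, k, k+1] = pm []"
    using assms by (auto simp: fun_eq_iff transpose_def)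
  ultimately have 1: "E n [k, ?l, k, ?l, k, ?l] []" 
    unfolding fmul_word_rel E_def by auto
  \<comment> \<open>Inserted pairs complete the relator of length six; what remains after its
    removal is l k l, the inverse of its second half.\<close>
  have "E n [k, ?l, k] ([k, ?l, k] @ [?l, ?l])" 
    using E_cancel[of ?l n "[k, ?l, k]" "[]"] assms by (auto intro: E_sym)
  also have "E n ([k, ?l, k] @ [?l, ?l]) ([k, ?l, k, ?l] @ [k, k] @ [?l])"
    using E_cancel[of k n "[k, ?l, k, ?l]" "[?l]"] assms by (auto intro: E_sym)
  also have "E n ([k, ?l, k, ?l] @ [k, k] @ [?l]) ([k, ?l, k, ?l, k] @ [?l, ?l] @ [k, ?l])"
    using E_cancel[of ?l n "[k, ?l, k, ?l, k]" "[k, ?l]"] assms by (auto intro: E_sym)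
  also have "E n ([k, ?l, k, ?l, k] @ [?l, ?l] @ [k, ?l]) [?l, k, ?l]"
    using E_ctx[OF 1, of "[]" "[?l, k, ?l]"] assms by simp
  finally show ?thesis by (rule E_sym)
qed

lemma E_commute_word:
  assumes "1 \<le> k" "k < n" "\<And>l. l \<in> set x \<Longrightarrow> 1 \<le> l \<and> l < n \<and> (Suc k < l \<or> Suc l < k)"
  shows "E n (x @ [k]) (k # x)"
  using assms(3)
proof (induction x)
  case (Cons l x)
  have "E n ([l] @ (x @ [k]) @ []) ([l] @ (k # x) @ [])"
    by (rule E_ctx) (use Cons in auto)
  also have "E n ([l] @ (k # x) @ []) ([] @ [l, k] @ x)" by simp
  also have "E n ([] @ [l, k] @ x) ([] @ [k, l] @ x)"
    by (rule E_ctx, rule E_commute) (use Cons.prems assms in fastforce)+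
  finally show ?case by simp
qed simp

text \<open>The word m, m - 1, ..., j, empty for j = Suc m. These are the minimal coset
  representatives of the symmetric group on m points in the one on m + 1 points.\<close>

definition dn :: "nat \<Rightarrow> nat \<Rightarrow> nat list" where "dn m j = rev [j..<Suc m]"

text \<open>A letter right of the descending run slides through it if k + 1 < j, extends the run if
  k + 1 = j, cancels its last letter if k = j, and otherwise crosses it by a braid move and leaves
  on the left as k - 1.\<close>

lemma dn_snoc_letter:
  assumes "1 \<le> k" "k \<le> m" "m < n" "1 \<le> j" "j \<le> Suc m"
  shows "\<exists>u' j'. set u' \<subseteq> {1..<m} \<and> 1 \<le> j' \<and> j' \<le> Suc m \<and> E n (dn m j @ [k]) (u' @ dn m j')"
proof -
  consider "Suc k < j" | "Suc k = j" | "k = j" | "j < k" by linarith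
  then show ?thesis
  proof cases
    case 1
    have "E n (dn m j @ [k]) ([k] @ dn m j)"
      using E_commute_word[of k n "dn m j"] 1 assms by (force simp: dn_def simp del: upt_Suc)
    then show ?thesis using 1 assms by (intro exI[of _ "[k]"] exI[of _ j]) auto
  next
    case 2
    have "dn m j @ [k] = [] @ dn m k"
      using 2 assms by (simp add: dn_def upt_conv_Cons)
    then show ?thesis using assms by (intro exI[of _ "[]"] exI[of _ k]) auto
  next
    case 3
    have "dn m j @ [k] = dn m (Suc j) @ [j, j] @ []"
      using 3 assms by (simp add: dn_def upt_conv_Cons)
    also have "E n \<dots> (dn m (Suc j) @ [])"
      by (rule E_cancel) (use 3 assms in \<open>auto simp: dn_def\<close>)
    finally show ?thesis using 3 assms by (intro exI[of _ "[]"] exI[of _ "Suc j"]) auto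
  next
    case 4
    \<comment> \<open>The letter k = i + 1 commutes with the tail below i, meets i + 1, i, turns
      into i by the braid rule, and this i commutes with the letters above i + 1.\<close>
    define i where "i = k - 1"
    have k: "k = Suc i" and i: "j \<le> i" using 4 by (auto simp: i_def)
    have "[j..<Suc m] = [j..<i] @ [i..<Suc m]" using i assms k
      using upt_add_eq_append[of j i "Suc m - i"] by (simp del: upt_Suc)
    also have "[i..<Suc m] = i # Suc i # [Suc (Suc i)..<Suc m]"
      using assms k by (simp add: upt_conv_Cons)
    finally have d: "dn m j = rev [Suc (Suc i)..<Suc m] @ [Suc i, i] @ rev [j..<i]"
      by (simp add: dn_def)
    let ?a = "rev [Suc (Suc i)..<Suc m]" and ?b = "rev [j..<i]"
    have "dn m j @ [k] = (?a @ [Suc i, i]) @ (?b @ [k]) @ []" by (simp add: d)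
    also have "E n \<dots> ((?a @ [Suc i, i]) @ (k # ?b) @ [])"
      by (rule E_ctx, rule E_commute_word) (use assms i k in auto)
    also have "(?a @ [Suc i, i]) @ (k # ?b) @ [] = ?a @ [Suc i, i, Suc i] @ ?b" by (simp add: k)
    also have "E n \<dots> (?a @ [i, Suc i, i] @ ?b)"
      by (rule E_ctx, rule E_braid) (use assms i k in auto)
    also have "?a @ [i, Suc i, i] @ ?b = [] @ (?a @ [i]) @ ([Suc i, i] @ ?b)" by simp
    also have "E n \<dots> ([] @ (i # ?a) @ ([Suc i, i] @ ?b))"
      by (rule E_ctx, rule E_commute_word) (use assms i k in auto)
    also have "[] @ (i # ?a) @ ([Suc i, i] @ ?b) = [i] @ dn m j" by (simp add: d)
    finally show ?thesis using assms i k by (intro exI[of _ "[i]"] exI[of _ j]) auto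
  qed
qed

lemma word_normal_form:
  assumes "set u \<subseteq> {1..<Suc m}" "m < n"
  shows "\<exists>u' j. set u' \<subseteq> {1..<m} \<and> 1 \<le> j \<and> j \<le> Suc m \<and> E n u (u' @ dn m j)"
  using assms(1)
proof (induction u rule: rev_induct)
  case Nil
  show ?case by (rule exI[of _ "[]"], rule exI[of _ "Suc m"]) (simp add: dn_def)
next
  case (snoc k u)
  then obtain u' j where 1: "set u' \<subseteq> {1..<m}" "1 \<le> j" "j \<le> Suc m" "E n u (u' @ dn m j)"
    by auto
  have k: "1 \<le> k" "k \<le> m" using snoc.prems by auto
  obtain u2 j2 where 2: "set u2 \<subseteq> {1..<m}" "1 \<le> j2" "j2 \<le> Suc m" "E n (dn m j @ [k]) (u2 @ dn m j2)"
    using dn_snoc_letter[OF k assms(2) 1(2,3)] by blast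
  have "E n ([] @ u @ [k]) ([] @ (u' @ dn m j) @ [k])"
    by (rule E_ctx) (use 1 k assms in auto)
  also have "[] @ (u' @ dn m j) @ [k] = u' @ (dn m j @ [k]) @ []" by simp
  also have "E n \<dots> (u' @ (u2 @ dn m j2) @ [])"
    by (rule E_ctx) (use 1 2 assms in auto)
  finally have "E n (u @ [k]) ((u' @ u2) @ dn m j2)" by simp
  then show ?case using 1 2 by (intro exI[of _ "u' @ u2"] exI[of _ j2]) auto
qed

lemma pm_dn: "j \<le> Suc m \<Longrightarrow> pm (dn m j) j = Suc m"
proof (induction "Suc m - j" arbitrary: j)
  case 0
  then show ?case by (simp add: dn_def)
next
  case (Suc d)
  then have "dn m j = dn m (Suc j) @ [j]" by (simp add: dn_def upt_conv_Cons del: upt_Suc)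
  then show ?case using Suc(1)[of "Suc j"] Suc(2,3) by simp
qed

text \<open>The permutation determines the rightmost factor of the normal form, since that factor is
  given by the preimage of the largest point.\<close>
lemma pm_eq_imp_E:
  assumes "set u \<subseteq> {1..<m}" "set v \<subseteq> {1..<m}" "m \<le> n" "pm u = pm v"
  shows "E n u v"
  using assms
proof (induction m arbitrary: u v)
  case (Suc m)
  have m: "m < n" using Suc by simp
  obtain u' i where 1: "set u' \<subseteq> {1..<m}" "1 \<le> i" "i \<le> Suc m" "E n u (u' @ dn m i)"
    using word_normal_form[OF Suc.prems(1) m] by blast
  obtain v' j where 2: "set v' \<subseteq> {1..<m}" "1 \<le> j" "j \<le> Suc m" "E n v (v' @ dn m j)"
    using word_normal_form[OF Suc.prems(2) m] by blast
  have eq: "pm u' \<circ> pm (dn m i) = pm v' \<circ> pm (dn m j)"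
    using 1(4) 2(4) Suc.prems(4) by (simp add: E_def)
  \<comment> \<open>Words with letters below m permute only the points 1, ..., m.\<close>
  have fixed: "pm u' (Suc m) = Suc m" "pm v' (Suc m) = Suc m"
    using pm_permutes[OF 1(1)] pm_permutes[OF 2(1)] by (auto intro: permutes_not_in)
  have "(pm u' \<circ> pm (dn m i)) i = Suc m" "(pm v' \<circ> pm (dn m j)) j = Suc m"
    using fixed pm_dn 1 2 by simp_all
  moreover have "inj (pm u' \<circ> pm (dn m i))" using pm_bij[of "u' @ dn m i"] by (simp add: bij_def)
  ultimately have "i = j" using eq by (metis injD)
  have "pm u' = pm v'"
  proof -
    let ?d = "pm (dn m i)"
    have d: "?d \<circ> inv ?d = id" using pm_bij[of "dn m i"] by (metis bij_is_surj surj_iff)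
    have "pm u' = (pm u' \<circ> ?d) \<circ> inv ?d" by (simp only: comp_assoc d comp_id)
    also have "\<dots> = (pm v' \<circ> ?d) \<circ> inv ?d" using eq \<open>i = j\<close> by simp
    also have "\<dots> = pm v'" by (simp only: comp_assoc d comp_id)
    finally show ?thesis .
  qed
  then have "E n u' v'" using Suc.IH 1 2 Suc.prems by simp
  then have "E n ([] @ u' @ dn m i) ([] @ v' @ dn m i)"
    by (rule E_ctx) (use m 1 in \<open>auto simp: dn_def\<close>)
  then have "E n (u' @ dn m i) (v' @ dn m j)" using \<open>i = j\<close> by simp
  then show ?case using 1(4) E_sym[OF 2(4)] by (blast intro: E_trans)
qed simp

section \<open>Faithfulness of Phi modulo the ideal\<close>

text \<open>The Clifford half of \<open>opw\<close>. Each factor squares to 1, so reversal inverts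
  \<open>K w\<close>.\<close>

definition K :: "nat list \<Rightarrow> lin" where "K w = prod_list (map (\<lambda>k. h * V k (Suc k)) w)"

lemma K_simps [simp]: "K [] = 1" "K (k # w) = h * V k (Suc k) * K w" "K (u @ v) = K u * K v"
  by (simp_all add: K_def)

lemma P_K: "P q * K w = K w * P q"
proof (induction w)
  case (Cons k w)
  then show ?case by (simp add: mult.assoc P_h_left P_V_left)
qed simp

lemma opw_K: "opw w = K w * P (pm w)"
proof (induction w)
  case (Cons k w)
  have "opw (k # w) = h * V k (Suc k) * (P (transpose k (Suc k)) * K w) * P (pm w)"
    using Cons by (simp add: T_def tauop_def mult.assoc)
  then show ?case by (simp add: P_K mult.assoc P_mult comp_def)
qed (simp only: opw_simps pm_simps K_simps P_id mult_1_left)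

lemma K_rev: "K (rev w) * K w = 1"
proof (induction w)
  case (Cons k w)
  have "h * V k (Suc k) * (h * V k (Suc k)) = 1"
    using tauop_sq[of k "Suc k"] by (simp add: tauop_def hVP_simps)
  then have "K (rev w) * (h * V k (Suc k) * (h * V k (Suc k))) * K w = 1"
    using Cons by simp
  then show ?case by (simp add: mult.assoc)
qed simp

text \<open>The projection to the slice p = q. Two such projections around a \<open>P\<close> read
  off a matrix entry of the regular representation and commute with the Clifford part.\<close>

lift_definition D :: "(nat \<Rightarrow> nat) \<Rightarrow> lin" is "\<lambda>q F (S, p). if p = q then F (S, p) else 0"
  by (auto simp: fun_eq_iff)

lemma ap_D [simp]: "ap (D q) F (S, p) = (if p = q then F (S, p) else 0)" by (simp add: D.rep_eq)

lemma D_C: "D q * C i = C i * D q"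
  by (rule lin_eqI) auto

lemma D_K: "D q * K w = K w * D q"
proof (induction w)
  case (Cons k w)
  have "D q * (h * X) = h * (D q * X)" for X by (rule h_left_comm)
  moreover have "D q * (V k (Suc k) * X) = V k (Suc k) * (D q * X)" for X
    unfolding V_def by (simp add: algebra_simps D_C flip: mult.assoc)
  ultimately show ?case using Cons by (simp add: mult.assoc)
qed simp

lemma D_K_left: "D q * (K w * X) = K w * (D q * X)"
  by (metis D_K mult.assoc)

lemma D_P_D: "D id * (P q * D r) = (if q = r then D id * P r else 0)"
  by (rule lin_eqI) auto

lemma D_P_nonzero: 
  assumes "of_c c * (D id * P r) = 0" shows "c = 0"
proof -
  have "ap (of_c c * (D id * P r)) (\<lambda>x. 1) ({}, id) = 0" using assms by simp
  then show ?thesis by simp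
qed

text \<open>Every word is congruent, up to sign, to a chosen word for its permutation. If
  \<open>Phi f\<close> is 0, the replacements sum to 0, so f is the sum of the replacement errors,
  which lie in the ideal.\<close>

lemma Phi_zero_imp_rel_ideal:
  assumes poly: "is_poly n f" and zero: "Phi f = 0"
  shows "f \<in> rel_ideal n"
proof -
  let ?A = "{w. f w \<noteq> 0}"
  define r where "r q = (SOME v. set v \<subseteq> {1..<n} \<and> pm v = q)" for q
  have fin: "finite ?A" and letters: "\<And>u. u \<in> ?A \<Longrightarrow> set u \<subseteq> {1..<n}"
    using poly by (auto simp: is_poly_def)
  have r: "set (r (pm u)) \<subseteq> {1..<n} \<and> pm (r (pm u)) = pm u" if "u \<in> ?A" for u
    unfolding r_def by (rule someI[of _ u]) (use letters[OF that] in auto)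
  have "\<exists>e. (e = 1 \<or> e = -1) \<and> fdiff (fword u) (fscale e (fword (r (pm u)))) \<in> rel_ideal n
       \<and> opw u = of_c e * opw (r (pm u))" if "u \<in> ?A" for u
    by (rule E_opw[OF pm_eq_imp_E[where m = n]]) (use letters[OF that] r[OF that] in auto)
  then obtain e where e: "\<And>u. u \<in> ?A \<Longrightarrow> fdiff (fword u) (fscale (e u) (fword (r (pm u)))) \<in> rel_ideal n
       \<and> opw u = of_c (e u) * opw (r (pm u))"
    by metis
  define g where "g = fsum (\<lambda>u. fscale (f u * e u) (fword (r (pm u)))) ?A"
  have coeff: "(\<Sum>u | u \<in> ?A \<and> pm u = q. f u * e u) = 0" if "q \<in> pm ` ?A" for q
  proof -
    \<comment> \<open>\<open>D id\<close> and \<open>D q\<close> select the words with permutation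
      q; \<open>K (rev (r q))\<close> then cancels their common Clifford factor and leaves a
      scalar.\<close>
    have "0 = K (rev (r q)) * D id * Phi f * D q" by (simp add: zero)
    also have "\<dots> = (\<Sum>u\<in>?A. K (rev (r q)) * (D id * (of_c (f u * e u) * K (r (pm u)) * P (pm u)) * D q))"
      unfolding Phi_def sum_distrib_left sum_distrib_right
    proof (rule sum.cong[OF refl])
      fix u assume u: "u \<in> ?A"
      have "opw u = of_c (e u) * (K (r (pm u)) * P (pm u))"
        using e[OF u] opw_K[of "r (pm u)"] r[OF u] by argo
      then have "of_c (f u) * opw u = of_c (f u * e u) * K (r (pm u)) * P (pm u)"
        by (simp only: of_c_mult mult.assoc)
      then show "K (rev (r q)) * D id * (of_c (f u) * opw u) * D q
        = K (rev (r q)) * (D id * (of_c (f u * e u) * K (r (pm u)) * P (pm u)) * D q)"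
        by (simp only: mult.assoc)
    qed
    also have "\<dots> = (\<Sum>u\<in>?A. if pm u = q then of_c (f u * e u) * (D id * P q) else 0)"
    proof (rule sum.cong[OF refl])
      fix u
      let ?c = "of_c (f u * e u)"
      have "K (rev (r q)) * (D id * (?c * K (r (pm u)) * P (pm u)) * D q)
         = ?c * (K (rev (r q)) * (K (r (pm u)) * (D id * (P (pm u) * D q))))"
        by (simp add: mult.assoc D_K_left of_c_left_comm[of "K w" for w] of_c_left_comm[of "D q" for q])
      also have "\<dots> = (if pm u = q then ?c * (D id * P q) else 0)"
      proof (cases "pm u = q")
        case True
        have "K (rev (r q)) * (K (r q) * X) = X" for X
          using K_rev[of "r q"] by (metis mult.assoc mult_1_left)
        then show ?thesis using True by (simp add: D_P_D)
      qed (simp add: D_P_D)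
      finally show "K (rev (r q)) * (D id * (?c * K (r (pm u)) * P (pm u)) * D q) = \<dots>" .
    qed
    also have "\<dots> = (\<Sum>u | u \<in> ?A \<and> pm u = q. of_c (f u * e u) * (D id * P q))"
      by (rule sum.inter_filter[OF fin, symmetric])
    also have "\<dots> = of_c (\<Sum>u | u \<in> ?A \<and> pm u = q. f u * e u) * (D id * P q)"
      by (simp only: of_c_sum sum_distrib_right)
    finally show ?thesis by (rule D_P_nonzero[OF sym])
  qed
  have "g w = 0" for w
  proof -
    have "g w = (\<Sum>u\<in>?A. if r (pm u) = w then f u * e u else 0)"
      unfolding g_def fsum_def fscale_def fword_def by (rule sum.cong[OF refl]) simp
    also have "\<dots> = (\<Sum>u | u \<in> ?A \<and> r (pm u) = w. f u * e u)"
      by (rule sum.inter_filter[OF fin, symmetric])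
    finally have g: "g w = (\<Sum>u | u \<in> ?A \<and> r (pm u) = w. f u * e u)" .
    show ?thesis
    proof (cases "\<exists>u\<in>?A. r (pm u) = w")
      case True
      then obtain u0 where u0: "u0 \<in> ?A" "r (pm u0) = w" by blast
      have "{u. u \<in> ?A \<and> r (pm u) = w} = {u. u \<in> ?A \<and> pm u = pm u0}"
      proof (rule Collect_cong, intro conj_cong refl iffI)
        fix u assume "u \<in> ?A" "r (pm u) = w"
        then have "pm (r (pm u)) = pm (r (pm u0))" using u0 by simp
        then show "pm u = pm u0" using r[OF \<open>u \<in> ?A\<close>] r[OF u0(1)] by simp
      qed (use u0 in simp)
      then show ?thesis using coeff[of "pm u0"] u0(1) by (simp only: g imageI)
    next
      case False
      then have "{u. u \<in> ?A \<and> r (pm u) = w} = {}" by blast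
      then show ?thesis by (simp only: g sum.empty)
    qed
  qed
  then have "f = fsum (\<lambda>u. fscale (f u) (fdiff (fword u) (fscale (e u) (fword (r (pm u)))))) ?A"
  proof -
    assume g0: "\<And>w. g w = 0"
    have "f w = fsum (\<lambda>u. fscale (f u) (fdiff (fword u) (fscale (e u) (fword (r (pm u)))))) ?A w" for w
    proof -
      have "fsum (\<lambda>u. fscale (f u) (fdiff (fword u) (fscale (e u) (fword (r (pm u)))))) ?A w
        = (\<Sum>u\<in>?A. if u = w then f u else 0) - g w"
        unfolding g_def fsum_def fscale_def fdiff_def sum_subtractf[symmetric]
        by (intro sum.cong) (auto simp: fword_def algebra_simps)
      then show ?thesis using g0 fin by (simp add: sum.delta)
    qed
    then show ?thesis by blast
  qed
  moreover have "\<dots> \<in> rel_ideal n"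
    by (rule rel_ideal_fsum) (use e in \<open>auto intro: rel_ideal.scale\<close>)
  ultimately show ?thesis by simp
qed

lemma rel_ideal_iff: "f \<in> rel_ideal n \<longleftrightarrow> is_poly n f \<and> Phi f = 0"
  using Phi_zero_imp_rel_ideal rel_ideal_poly_Phi by blast

section \<open>The elements tau\<close>

text \<open>The minus sign in the recursion for tau_ij cancels the one in
  \<open>tauop_conj\<close>.\<close>

lemma tt_poly_Phi:
  "1 \<le> i \<Longrightarrow> i + d < n \<Longrightarrow> is_poly n (tt i d) \<and> Phi (tt i d) = tauop i (Suc (i + d))"
proof (induction d)
  case 0
  then show ?case by (simp add: is_poly_fword T_def)
next
  case (Suc d)
  let ?m = "Suc (i + d)"
  have IH: "is_poly n (tt i d)" "Phi (tt i d) = tauop i ?m" using Suc by auto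
  have w: "is_poly n (fword [?m])" using Suc by (auto intro!: is_poly_fword)
  have p1: "is_poly n (fmul (tt i d) (fword [?m]))" using IH w by (simp add: is_poly_fmul)
  have p2: "is_poly n (fmul (fmul (tt i d) (fword [?m])) (tt i d))" using IH p1 by (simp add: is_poly_fmul)
  have "tauop i ?m * tauop ?m (Suc ?m) * tauop i ?m = - tauop i (Suc ?m)"
    using tauop_conj[of i ?m ?m "Suc ?m"] by (simp add: transpose_def)
  then show ?case
    using IH w p1 p2 by (simp add: is_poly_fneg Phi_fneg[of n] Phi_fmul[of n] T_def)
qed

lemma is_poly_tau:
  assumes "i \<in> {1..n}" "j \<in> {1..n}"
  shows "is_poly n (tau i j)"
  using assms tt_poly_Phi[of i "j - i - 1" n] tt_poly_Phi[of j "i - j - 1" n]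
  by (auto simp: tau_def is_poly_fneg is_poly_zero)

lemma Phi_tau:
  assumes "i \<in> {1..n}" "j \<in> {1..n}" "i \<noteq> j"
  shows "Phi (tau i j) = tauop i j"
  using assms tt_poly_Phi[of i "j - i - 1" n] tt_poly_Phi[of j "i - j - 1" n]
  by (auto simp: tau_def Phi_fneg[of n] tauop_swap[of j i])

section \<open>Cycles and products of disjoint cycles as operators\<close>

fun cycop :: "nat list \<Rightarrow> lin" where
  "cycop (a # b # c) = tauop a b * cycop (b # c)"
| "cycop _ = 1"

lemma is_poly_tcyc: "set c \<subseteq> {1..n} \<Longrightarrow> is_poly n (tcyc c)"
  by (induction c rule: tcyc.induct) (auto intro!: is_poly_fmul is_poly_tau is_poly_fword)

lemma Phi_tcyc: "set c \<subseteq> {1..n} \<Longrightarrow> distinct c \<Longrightarrow> Phi (tcyc c) = cycop c"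
proof (induction c rule: tcyc.induct)
  case (1 a b c)
  then have "is_poly n (tau a b)" "is_poly n (tcyc (b # c))"
    by (auto intro!: is_poly_tau is_poly_tcyc simp del: tcyc.simps)
  then show ?case using 1 Phi_tau[of a n b] by (auto simp: Phi_fmul[of n])
qed auto

definition blkop :: "nat list list \<Rightarrow> lin" where "blkop css = prod_list (map cycop css)"

lemma blkop_simps [simp]: "blkop [] = 1" "blkop (c # css) = cycop c * blkop css"
  by (simp_all add: blkop_def)

definition cperm :: "nat list list \<Rightarrow> nat \<Rightarrow> nat" where
  "cperm css = foldr (\<lambda>c f. cycle_of_list c \<circ> f) css id"

lemma cperm_simps: "cperm [] = id" "cperm (c # css) = cycle_of_list c \<circ> cperm css"
  by (simp_all add: cperm_def)

lemma cperm_outside: "x \<notin> set (concat css) \<Longrightarrow> cperm css x = x"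
  by (induction css) (auto simp: cperm_simps id_outside_supp)

lemma cycle_of_list_in_set: "x \<in> set c \<Longrightarrow> cycle_of_list c x \<in> set c"
  using cycle_permutes[of c] by (simp add: permutes_in_image)

lemma cperm_inside:
  assumes "distinct (concat css)" "c \<in> set css" "x \<in> set c"
  shows "cperm css x = cycle_of_list c x"
  using assms
proof (induction css)
  case (Cons d css)
  show ?case
  proof (cases "c \<in> set css")
    case True
    then have "x \<notin> set d" "cycle_of_list c x \<notin> set d" 
      using Cons.prems cycle_of_list_in_set[OF Cons.prems(3)] by auto
    then show ?thesis using Cons True by (simp add: cperm_simps id_outside_supp)
  next
    case False
    then have "c = d" "x \<notin> set (concat css)" using Cons.prems by auto
    then show ?thesis by (simp add: cperm_simps cperm_outside del: set_concat)
  qed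
qed simp

lemma cperm_cong_set:
  assumes "distinct (concat css)" "distinct (concat css')" "set css = set css'"
  shows "cperm css = cperm css'"
proof
  fix x
  show "cperm css x = cperm css' x"
  proof (cases "x \<in> set (concat css)")
    case True
    then obtain c where "c \<in> set css" "x \<in> set c" by auto
    then show ?thesis using assms by (simp add: cperm_inside)
  next
    case False
    then have "x \<notin> set (concat css')" using assms by simp
    then show ?thesis using False by (simp only: cperm_outside not_False_eq_True)
  qed
qed

lemma distinct_concat_mset: "mset css = mset css' \<Longrightarrow> distinct (concat css) \<longleftrightarrow> distinct (concat css')"
proof -
  assume "mset css = mset css'"
  then have "image_mset mset (mset css) = image_mset mset (mset css')" by simp
  then have "mset (concat css) = mset (concat css')"
    by (metis mset_concat mset_map sum_mset_sum_list)
  then show ?thesis by (rule mset_eq_imp_distinct_iff)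
qed

text \<open>Disjoint cycles may be listed in any order. This allows moving a chosen cycle to the
  front and sorting the cycles by length.\<close>

lemma cperm_mset:
  assumes "mset css = mset css'" "distinct (concat css)"
  shows "cperm css = cperm css'"
  using assms distinct_concat_mset[OF assms(1)] mset_eq_setD[OF assms(1)] by (intro cperm_cong_set) auto

lemma cperm_filter: "cperm (filter (\<lambda>c. length c \<noteq> 1 \<and> c \<noteq> []) css) = cperm css"
proof (induction css)
  case (Cons c css)
  have "cycle_of_list c = id" if "\<not> (length c \<noteq> 1 \<and> c \<noteq> [])"
    using that by (cases c rule: cycle_of_list.cases) auto
  then show ?case using Cons by (auto simp: cperm_simps)
qed simp

lemma distinct_concat_filter: "distinct (concat css) \<Longrightarrow> distinct (concat (filter Q css))"
  by (induction css) auto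

lemma permutes_cycles:
  assumes "q permutes {1..n}"
  obtains css where "cperm css = q" "distinct (concat css)" "set (concat css) \<subseteq> {1..n}"
    "\<And>c. c \<in> set css \<Longrightarrow> 2 \<le> length c"
proof -
  have "cycle_decomp {1..n} q" using assms by (simp add: cycle_decomposition)
  then have "\<exists>css. cperm css = q \<and> distinct (concat css) \<and> set (concat css) = {1..n}"
  proof (induction rule: cycle_decomp.induct)
    case empty
    then show ?case by (intro exI[of _ "[]"]) (simp add: cperm_simps)
  next
    case (comp I p cs)
    then obtain css where "cperm css = p" "distinct (concat css)" "set (concat css) = I" by blast
    then show ?case using comp by (intro exI[of _ "cs # css"]) (auto simp: cperm_simps)
  qed
  then obtain css where css: "cperm css = q" "distinct (concat css)" "set (concat css) = {1..n}" by blast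
  \<comment> \<open>The decomposition covers all of {1..n}, so fixed points occur as one-element
    lists; these and empty lists are dropped.\<close>
  let ?d = "filter (\<lambda>c. length c \<noteq> 1 \<and> c \<noteq> []) css"
  have len: "2 \<le> length c" if "c \<in> set ?d" for c
    using that by (cases c rule: cycle_of_list.cases) auto
  have sub: "set (concat ?d) \<subseteq> {1..n}" using css(3) by auto
  have "cperm ?d = q" using css(1) by (simp only: cperm_filter)
  then show ?thesis by (rule that[OF _ distinct_concat_filter[OF css(2)] sub len])
qed

section \<open>Cycle products as signed words in the generators\<close>

definition is_word :: "nat \<Rightarrow> lin \<Rightarrow> (nat \<Rightarrow> nat) \<Rightarrow> bool" where
  "is_word n X q \<longleftrightarrow> (\<exists>w e. set w \<subseteq> {1..<n} \<and> (e = 1 \<or> e = -1) \<and> X = of_c e * opw w \<and> pm w = q)"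

lemma is_word_one: "is_word n 1 id"
  unfolding is_word_def by (rule exI[of _ "[]"], rule exI[of _ 1]) simp

lemma is_word_mult: 
  assumes "is_word n X q" "is_word n Y r" shows "is_word n (X * Y) (q \<circ> r)"
proof -
  obtain v w d e where "set v \<subseteq> {1..<n}" "set w \<subseteq> {1..<n}" "d = 1 \<or> d = -1" "e = 1 \<or> e = -1"
     "X = of_c d * opw v" "Y = of_c e * opw w" "pm v = q" "pm w = r"
    using assms unfolding is_word_def by metis
  then show ?thesis unfolding is_word_def
    by (intro exI[of _ "v @ w"] exI[of _ "d * e"]) (auto simp: of_c_mult)
qed

lemma is_word_minus: "is_word n X q \<Longrightarrow> is_word n (- X) q"
proof -
  assume "is_word n X q"
  then obtain w e where "set w \<subseteq> {1..<n}" "e = 1 \<or> e = -1" "X = of_c e * opw w" "pm w = q"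
    unfolding is_word_def by metis
  then show ?thesis unfolding is_word_def
    by (intro exI[of _ w] exI[of _ "-e"]) auto
qed

lemma is_word_T: "1 \<le> k \<Longrightarrow> k < n \<Longrightarrow> is_word n (T k) (transpose k (Suc k))"
  unfolding is_word_def by (rule exI[of _ "[k]"], rule exI[of _ 1]) simp

lemma is_word_tauop_less: "1 \<le> i \<Longrightarrow> Suc (i + d) \<le> n \<Longrightarrow> is_word n (tauop i (Suc (i + d))) (transpose i (Suc (i + d)))"
proof (induction d)
  case 0
  then show ?case using is_word_T[of i n] by (simp add: T_def)
next
  case (Suc d)
  let ?m = "Suc (i + d)"
  have eq: "tauop i (Suc ?m) = - (tauop i ?m * T ?m * tauop i ?m)"
    using tauop_conj[of i ?m ?m "Suc ?m"] by (simp add: transpose_def T_def)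
  have p: "transpose i (Suc ?m) = transpose i ?m \<circ> transpose ?m (Suc ?m) \<circ> transpose i ?m"
    by (auto simp: fun_eq_iff transpose_def)
  have "is_word n (tauop i (Suc ?m)) (transpose i (Suc ?m))"
    unfolding eq p by (intro is_word_minus is_word_mult is_word_T Suc.IH) (use Suc.prems in auto)
  then show ?case by simp
qed

lemma is_word_tauop:
  assumes "i \<in> {1..n}" "j \<in> {1..n}" "i \<noteq> j"
  shows "is_word n (tauop i j) (transpose i j)"
proof (cases "i < j")
  case True
  then show ?thesis using is_word_tauop_less[of i "j - i - 1" n] assms by simp
next
  case False
  then show ?thesis using is_word_minus[OF is_word_tauop_less[of j "i - j - 1" n]] assms 
    by (simp add: tauop_swap[of j i] transpose_commute)
qed

text \<open>\<open>cycop\<close> and \<open>cycle_of_list\<close> split off the same transposition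
  (a, b), so the recursions run in parallel.\<close>

lemma is_word_cycop: "distinct c \<Longrightarrow> set c \<subseteq> {1..n} \<Longrightarrow> is_word n (cycop c) (cycle_of_list c)"
proof (induction c rule: cycop.induct)
  case (1 a b c)
  then show ?case using is_word_mult[OF is_word_tauop[of a n b] "1.IH"] by (simp add: comp_def)
qed (simp_all only: cycop.simps cycle_of_list.simps is_word_one)

lemma is_word_blkop:
  "distinct (concat css) \<Longrightarrow> set (concat css) \<subseteq> {1..n} \<Longrightarrow> is_word n (blkop css) (cperm css)"
  by (induction css) (auto simp only: blkop_simps cperm_simps is_word_one concat.simps distinct_append 
        set_append Un_subset_iff intro!: is_word_mult is_word_cycop)

text \<open>The cycle product is itself a signed word with the permutation of u, and words with
  equal permutation agree up to sign. Questions about words thus reduce to cycle products.\<close>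

lemma opw_eq_blkop:
  assumes "set u \<subseteq> {1..<n}" "pm u = cperm css" "distinct (concat css)" "set (concat css) \<subseteq> {1..n}"
  shows "\<exists>e. (e = 1 \<or> e = -1) \<and> opw u = of_c e * blkop css"
proof -
  obtain w d where w: "set w \<subseteq> {1..<n}" "d = 1 \<or> d = -1" "blkop css = of_c d * opw w" "pm w = cperm css"
    using is_word_blkop[OF assms(3,4)] unfolding is_word_def by metis
  obtain e where e: "e = 1 \<or> e = -1" "opw u = of_c e * opw w"
    using E_opw[OF pm_eq_imp_E[OF assms(1) w(1) order_refl]] w assms by auto
  have "of_c d * (of_c d * X) = X" for X
    using w(2) by auto
  then have "opw u = of_c (e * d) * blkop css"
    using e w by (simp add: of_c_mult mult.assoc)
  then show ?thesis using w(2) e(1) by (intro exI[of _ "e * d"]) auto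
qed

lemma permutes_word:
  assumes "q permutes {1..n}"
  shows "\<exists>w. set w \<subseteq> {1..<n} \<and> pm w = q"
proof -
  obtain css where "cperm css = q" "distinct (concat css)" "set (concat css) \<subseteq> {1..n}"
    using permutes_cycles[OF assms] by blast
  then show ?thesis using is_word_blkop[of css n] unfolding is_word_def by auto
qed

text \<open>A cycle of odd length has an even number of \<open>tauop\<close> factors, so the signs
  of \<open>tauop_conj\<close> cancel in pairs. Hence the induction removes two letters at a
  time.\<close>

lemma cycop_conj:
  "distinct c \<Longrightarrow> odd (length c) \<Longrightarrow> T k * cycop c * T k = cycop (map (transpose k (Suc k)) c)"
proof (induction c rule: induct_list012)
  case (3 a b r)
  let ?s = "transpose k (Suc k)"
  show ?case
  proof (cases r)
    case (Cons c r')
    have "T k * cycop (a # b # r) * T k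
       = (T k * tauop a b * T k) * (T k * tauop b c * T k) * (T k * cycop r * T k)"
      by (simp add: Cons mult.assoc)
    also have "\<dots> = tauop (?s a) (?s b) * tauop (?s b) (?s c) * cycop (map ?s r)"
    proof -
      have "T k * tauop a b * T k = - tauop (?s a) (?s b)" "T k * tauop b c * T k = - tauop (?s b) (?s c)"
        unfolding T_def by (rule tauop_conj; use 3(3) Cons in auto)+
      then show ?thesis using 3 by simp
    qed
    also have "\<dots> = cycop (map ?s (a # b # r))" by (simp add: Cons mult.assoc)
    finally show ?thesis .
  qed (use 3 in simp)
qed auto

lemma blkop_conj:
  "(\<And>c. c \<in> set css \<Longrightarrow> distinct c \<and> odd (length c)) \<Longrightarrow>
     T k * blkop css * T k = blkop (map (map (transpose k (Suc k))) css)"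
proof (induction css)
  case (Cons c css)
  have "T k * blkop (c # css) * T k = (T k * cycop c * T k) * (T k * blkop css * T k)"
    by (simp add: mult.assoc)
  then show ?case using Cons by (simp add: cycop_conj)
qed simp

lemma distinct_map_pm: "distinct c \<Longrightarrow> distinct (map (pm g) c)"
  using pm_bij[of g] by (auto simp: distinct_map bij_def intro: inj_on_subset)

lemma blkop_conj_word:
  assumes "\<And>c. c \<in> set css \<Longrightarrow> distinct c \<and> odd (length c)"
  shows "opw g * blkop css * opw (rev g) = blkop (map (map (pm g)) css)"
proof (induction g)
  case Nil
  show ?case by simp
next
  case (Cons k g)
  have "opw (k # g) * blkop css * opw (rev (k # g)) = T k * (opw g * blkop css * opw (rev g)) * T k"
    by (simp add: mult.assoc)
  also have "\<dots> = T k * blkop (map (map (pm g)) css) * T k" by (simp only: Cons)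
  also have "\<dots> = blkop (map (map (transpose k (Suc k))) (map (map (pm g)) css))"
    by (rule blkop_conj) (use assms distinct_map_pm in auto)
  also have "map (map (transpose k (Suc k))) (map (map (pm g)) css) = map (map (pm (k # g))) css"
    by simp
  finally show ?case .
qed

section \<open>Vacuum expectation\<close>

text \<open>G has no component in which a mode from A is occupied. Factors built from letters
  outside A preserve this.\<close>

definition avoids :: "nat set \<Rightarrow> vec \<Rightarrow> bool" where
  "avoids A G \<longleftrightarrow> (\<forall>S p. S \<inter> A \<noteq> {} \<longrightarrow> G (S, p) = 0)"

lemma avoids_tauop:
  assumes "avoids A G" "i \<notin> A" "j \<notin> A"
  shows "avoids A (ap (tauop i j) G)"
proof -
  have "flip i S \<inter> A = S \<inter> A" "flip j S \<inter> A = S \<inter> A" for S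
    using assms by (auto simp: flip_def)
  then show ?thesis using assms(1) by (simp add: avoids_def tauop_def h_def V_def)
qed

lemma avoids_cycop: "avoids A G \<Longrightarrow> set c \<inter> A = {} \<Longrightarrow> avoids A (ap (cycop c) G)"
  by (induction c rule: cycop.induct) (auto intro: avoids_tauop)

lemma avoids_blkop: "avoids A G \<Longrightarrow> set (concat css) \<inter> A = {} \<Longrightarrow> avoids A (ap (blkop css) G)"
  by (induction css) (auto intro!: avoids_cycop simp: Int_Un_distrib2)

lemma avoids_mono: "avoids A G \<Longrightarrow> B \<subseteq> A \<Longrightarrow> avoids B G"
  unfolding avoids_def by blast

text \<open>In (C a - C b) (C b - C c) = C a C b - C a C c - 1 + C b C c only the summand -1 contributes,
  because nothing else can cancel the a or b in the other ones.\<close>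
lemma vacuum_two_step:
  assumes "distinct [a, b, c]" "avoids {a, b} G"
  shows "ap (tauop a b * tauop b c) G ({}, p) = - (1/2) * G ({}, p \<circ> transpose a b \<circ> transpose b c)"
proof -
  let ?P = "P (transpose a b \<circ> transpose b c)"
  have V: "V a b * V b c = C a * C b - C a * C c - 1 + C b * C c"
    by (simp add: V_def algebra_simps)
  have "tauop a b * tauop b c = h * (h * (V a b * V b c)) * ?P"
    by (simp add: tauop_def hVP_simps)
  moreover have "h * (h * X) = of_c (1/2) * X" for X
  proof -
    have "h * h = of_c (complex_of_real ((1 / sqrt 2) * (1 / sqrt 2)))"
      by (simp only: h_def of_c_mult of_real_mult)
    also have "(1 / sqrt 2) * (1 / sqrt 2) = (1/2::real)" by simp
    finally show ?thesis by (simp flip: mult.assoc)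
  qed
  ultimately have "tauop a b * tauop b c = of_c (1/2) * ((C a * C b - C a * C c - 1 + C b * C c) * ?P)"
    by (simp add: V mult.assoc)
  moreover have "G (flip b (flip a {}), q) = 0" "G (flip c (flip a {}), q) = 0"
     "G (flip c (flip b {}), q) = 0" for q
    using assms by (auto simp: avoids_def flip_def)
  ultimately show ?thesis by (simp add: comp_assoc)
qed

text \<open>Two letters a, b at a time are split off. They do not recur to the right, so
  \<open>vacuum_two_step\<close> applies even though the next letter may be occupied there; each
  pair contributes -1/2.\<close>

lemma vacuum_cycop:
  assumes "distinct c" "odd (length c)" "avoids (set c) G"
  shows "ap (cycop c) G ({}, p) = (- (1/2)) ^ (length c div 2) * G ({}, p \<circ> cycle_of_list c)"
  using assms
proof (induction c arbitrary: p rule: induct_list012)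
  case (3 a b r)
  show ?case
  proof (cases r)
    case (Cons c r')
    let ?G = "ap (cycop r) G"
    have "avoids {a, b} ?G"
      by (rule avoids_cycop, rule avoids_mono[OF 3(5)]) (use 3(3) in auto)
    then have "ap (tauop a b * tauop b c) ?G ({}, p) = - (1/2) * ?G ({}, p \<circ> transpose a b \<circ> transpose b c)"
      by (intro vacuum_two_step) (use 3(3) Cons in auto)
    moreover have "?G ({}, q) = (- (1/2)) ^ (length r div 2) * G ({}, q \<circ> cycle_of_list r)" for q
      by (rule 3(1)) (use 3 in \<open>auto intro: avoids_mono\<close>)
    ultimately show ?thesis by (simp add: Cons comp_def)
  qed (use 3 in simp)
qed auto

definition vsign :: "nat list \<Rightarrow> complex" where
  "vsign \<beta> = prod_list (map (\<lambda>l. (- (1/2)) ^ (l div 2)) \<beta>)"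

lemma vsign_nonzero: "vsign \<beta> \<noteq> 0"
  by (induction \<beta>) (simp_all add: vsign_def)

lemma vacuum_blkop:
  assumes "distinct (concat css)" "\<And>c. c \<in> set css \<Longrightarrow> odd (length c)" "avoids (set (concat css)) G"
  shows "ap (blkop css) G ({}, p) = vsign (map length css) * G ({}, p \<circ> cperm css)"
  using assms
proof (induction css arbitrary: p)
  case Nil
  show ?case by (simp add: vsign_def cperm_simps)
next
  case (Cons c css)
  have "avoids (set c) (ap (blkop css) G)"
    by (rule avoids_blkop, rule avoids_mono[OF Cons.prems(3)]) (use Cons.prems in auto)
  then have "ap (cycop c) (ap (blkop css) G) ({}, p)
     = (- (1/2)) ^ (length c div 2) * ap (blkop css) G ({}, p \<circ> cycle_of_list c)"
    by (intro vacuum_cycop) (use Cons.prems in auto)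
  moreover have "ap (blkop css) G ({}, q) = vsign (map length css) * G ({}, q \<circ> cperm css)" for q
    by (rule Cons.IH) (use Cons.prems in \<open>auto intro: avoids_mono\<close>)
  ultimately show ?case by (simp add: vsign_def cperm_simps comp_def)
qed

text \<open>The basis vector at the empty subset and q. Its image, read at the identity, detects
  products with permutation q.\<close>

definition vac :: "(nat \<Rightarrow> nat) \<Rightarrow> vec" where
  "vac q = (\<lambda>(S, p). if S = {} \<and> p = q then 1 else 0)"

lemma vac_blkop:
  assumes "distinct (concat css)" "\<And>c. c \<in> set css \<Longrightarrow> odd (length c)"
  shows "ap (blkop css) (vac q) ({}, id) = (if cperm css = q then vsign (map length css) else 0)"
proof -
  have "avoids A (vac q)" for A by (auto simp: avoids_def vac_def)
  then show ?thesis using vacuum_blkop[OF assms, where p = id] by (simp add: vac_def)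
qed

section \<open>Blocks and the elements Cel\<close>

lemma blocks_concat: "blocks (map length css) (concat css) = css"
  by (induction css) auto

lemma concat_blocks: "length xs = sum_list \<beta> \<Longrightarrow> concat (blocks \<beta> xs) = xs"
  by (induction \<beta> arbitrary: xs) auto

lemma length_blocks: "length xs = sum_list \<beta> \<Longrightarrow> map length (blocks \<beta> xs) = \<beta>"
  by (induction \<beta> arbitrary: xs) auto

lemma blocks_map: "blocks \<beta> (map f xs) = map (map f) (blocks \<beta> xs)"
  by (induction \<beta> arbitrary: xs) (auto simp: take_map drop_map)

definition inj_lists :: "nat \<Rightarrow> nat \<Rightarrow> nat list set" where
  "inj_lists n m = {xs. length xs = m \<and> distinct xs \<and> set xs \<subseteq> {1..n}}"

lemma finite_inj_lists: "finite (inj_lists n m)"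
  unfolding inj_lists_def
  by (rule finite_subset[OF _ finite_lists_length_eq[of "{1..n}" m]]) auto

lemma blocks_inj_lists:
  assumes "xs \<in> inj_lists n (sum_list \<beta>)"
  shows "distinct (concat (blocks \<beta> xs))" "set (concat (blocks \<beta> xs)) \<subseteq> {1..n}"
    "map length (blocks \<beta> xs) = \<beta>"
  using assms by (auto simp: inj_lists_def concat_blocks length_blocks simp del: set_concat)

lemma in_blocks:
  assumes "xs \<in> inj_lists n (sum_list \<beta>)" "c \<in> set (blocks \<beta> xs)"
  shows "distinct c" "set c \<subseteq> {1..n}" "length c \<in> set \<beta>"
proof -
  note b = blocks_inj_lists[OF assms(1)]
  show "distinct c" using b(1) assms(2) by (auto simp: distinct_concat_iff)
  show "set c \<subseteq> {1..n}" using b(2) assms(2) by auto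
  have "length c \<in> set (map length (blocks \<beta> xs))" using assms(2) by simp
  then show "length c \<in> set \<beta>" by (simp only: b(3))
qed

lemma Cel_alt: "Cel n \<alpha> = fsum (\<lambda>xs. fprod_list (map tcyc (blocks (filter (\<lambda>a. a \<noteq> 1) \<alpha>) xs)))
    (inj_lists n (sum_list (filter (\<lambda>a. a \<noteq> 1) \<alpha>)))"
  unfolding Cel_def inj_lists_def Let_def ..

lemma is_poly_Cel: "is_poly n (Cel n \<alpha>)"
  unfolding Cel_alt by (intro is_poly_fsum is_poly_fprod_list) (auto intro: is_poly_tcyc dest: in_blocks)

definition celop :: "nat \<Rightarrow> nat list \<Rightarrow> lin" where
  "celop n \<beta> = (\<Sum>xs\<in>inj_lists n (sum_list \<beta>). blkop (blocks \<beta> xs))"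

lemma Phi_Cel: "Phi (Cel n \<alpha>) = celop n (filter (\<lambda>a. a \<noteq> 1) \<alpha>)"
proof -
  let ?\<beta> = "filter (\<lambda>a. a \<noteq> 1) \<alpha>"
  have "Phi (Cel n \<alpha>) = (\<Sum>xs\<in>inj_lists n (sum_list ?\<beta>). Phi (fprod_list (map tcyc (blocks ?\<beta> xs))))"
    unfolding Cel_alt
    by (intro Phi_fsum is_poly_fprod_list) (auto intro: is_poly_tcyc dest: in_blocks)
  also have "\<dots> = celop n ?\<beta>"
    unfolding celop_def
  proof (rule sum.cong[OF refl])
    fix xs assume xs: "xs \<in> inj_lists n (sum_list ?\<beta>)"
    have "Phi (fprod_list (map tcyc (blocks ?\<beta> xs))) = prod_list (map Phi (map tcyc (blocks ?\<beta> xs)))"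
    proof (rule Phi_fprod_list)
      fix f assume "f \<in> set (map tcyc (blocks ?\<beta> xs))"
      then show "is_poly n f" unfolding set_map using is_poly_tcyc[OF in_blocks(2)[OF xs]] by blast
    qed
    also have "map Phi (map tcyc (blocks ?\<beta> xs)) = map cycop (blocks ?\<beta> xs)"
      unfolding map_map comp_def by (rule map_cong[OF refl Phi_tcyc]) (rule in_blocks[OF xs], assumption)+
    finally show "Phi (fprod_list (map tcyc (blocks ?\<beta> xs))) = blkop (blocks ?\<beta> xs)"
      by (simp add: blkop_def)
  qed
  finally show ?thesis .
qed

section \<open>Homogeneity of the elements \<open>Cel\<close>\<close>

lemma is_hom_fword: "is_hom (odd (length u)) (fword u)"
  by (auto simp: is_hom_def fword_def)

lemma is_hom_fmul: "is_hom p f \<Longrightarrow> is_hom q g \<Longrightarrow> is_hom (p \<noteq> q) (fmul f g)"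
  unfolding is_hom_def by (auto elim!: fmul_nonzero)

lemma is_hom_fneg: "is_hom p f \<Longrightarrow> is_hom p (fneg f)"
  by (simp add: is_hom_def fneg_def)

lemma is_hom_fsum: "(\<And>i. i \<in> S \<Longrightarrow> is_hom p (F i)) \<Longrightarrow> is_hom p (fsum F S)"
  unfolding is_hom_def fsum_def by (metis sum.neutral)

lemma is_hom_tt: "is_hom True (tt i d)"
proof (induction d)
  case 0
  show ?case using is_hom_fword[of "[i]"] by simp
next
  case (Suc d)
  have "is_hom True (fword [i + d + 1])" using is_hom_fword[of "[i + d + 1]"] by simp
  from is_hom_fmul[OF is_hom_fmul[OF Suc this] Suc] show ?case by (simp add: is_hom_fneg)
qed

lemma is_hom_tau: "is_hom True (tau i j)"
  by (auto simp: tau_def is_hom_tt is_hom_fneg) (simp add: is_hom_def)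

lemma is_hom_tcyc: "c \<noteq> [] \<Longrightarrow> is_hom (even (length c)) (tcyc c)"
proof (induction c rule: tcyc.induct)
  case (1 a b c)
  then show ?case using is_hom_fmul[OF is_hom_tau[of a b], of "even (length (b # c))" "tcyc (b # c)"] by auto
qed (use is_hom_fword[of "[]"] in auto)

lemma is_hom_fprod_list: "(\<And>f. f \<in> set fs \<Longrightarrow> is_hom False f) \<Longrightarrow> is_hom False (fprod_list fs)"
proof (induction fs)
  case Nil
  show ?case using is_hom_fword[of "[]"] by (simp add: fprod_list_def)
next
  case (Cons f fs)
  then show ?case using is_hom_fmul[of False f False "fprod_list fs"] by (simp add: fprod_list_def)
qed

section \<open>The elements Cel are central\<close>

text \<open>Conjugation renames the letters of each summand, and renaming by an adjacent
  transposition is an involution of the index lists.\<close>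

lemma celop_conj:
  assumes "\<And>a. a \<in> set \<beta> \<Longrightarrow> odd a" "1 \<le> k" "k < n"
  shows "T k * celop n \<beta> * T k = celop n \<beta>"
proof -
  let ?s = "transpose k (Suc k)" and ?I = "inj_lists n (sum_list \<beta>)"
  have s: "map ?s xs \<in> ?I" if "xs \<in> ?I" for xs
    using that assms by (auto simp: inj_lists_def distinct_map transpose_def inj_on_def split: if_splits)
  have "T k * celop n \<beta> * T k = (\<Sum>xs\<in>?I. T k * blkop (blocks \<beta> xs) * T k)"
    by (simp add: celop_def sum_distrib_left sum_distrib_right)
  also have "\<dots> = (\<Sum>xs\<in>?I. blkop (blocks \<beta> (map ?s xs)))"
    unfolding blocks_map
    by (intro sum.cong refl blkop_conj) (use assms(1) in \<open>auto dest: in_blocks\<close>)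
  also have "\<dots> = celop n \<beta>"
    unfolding celop_def
    by (rule sum.reindex_bij_witness[of _ "map ?s" "map ?s"]) (use s in \<open>auto simp: o_def\<close>)
  finally show ?thesis .
qed

lemma commute_words_imp_commute_poly:
  assumes "\<And>k. 1 \<le> k \<Longrightarrow> k < n \<Longrightarrow> T k * X = X * T k" "is_poly n b"
  shows "X * Phi b = Phi b * X"
proof -
  have w: "X * opw w = opw w * X" if "set w \<subseteq> {1..<n}" for w
    using that
  proof (induction w)
    case (Cons k w)
    then have "X * opw (k # w) = T k * X * opw w" using assms(1)[of k] by (simp flip: mult.assoc)
    then show ?case using Cons by (simp add: mult.assoc)
  qed simp
  have "X * Phi b = (\<Sum>u | b u \<noteq> 0. of_c (b u) * (X * opw u))"
    by (simp add: Phi_def sum_distrib_left of_c_left_comm)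
  also have "\<dots> = (\<Sum>u | b u \<noteq> 0. of_c (b u) * (opw u * X))"
    by (intro sum.cong refl) (use w assms(2) in \<open>auto simp: is_poly_def\<close>)
  finally show ?thesis by (simp add: Phi_def sum_distrib_right mult.assoc)
qed

lemma odd_partition_parts: "\<alpha> \<in> odd_partitions n \<Longrightarrow> a \<in> set \<alpha> \<Longrightarrow> odd a"
  by (simp add: odd_partitions_def)

lemma supercentral_Cel:
  assumes "\<alpha> \<in> odd_partitions n"
  shows "supercentral_hom n (Cel n \<alpha>)"
proof -
  let ?\<beta> = "filter (\<lambda>a. a \<noteq> 1) \<alpha>"
  have odd: "odd a" if "a \<in> set ?\<beta>" for a using that odd_partition_parts[OF assms] by auto
  \<comment> \<open>Each odd cycle has an even number of factors. The element is thus even, all its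
    supercommutation signs are 1, and centrality suffices.\<close>
  have hom: "is_hom False (Cel n \<alpha>)"
    unfolding Cel_alt
  proof (intro is_hom_fsum is_hom_fprod_list)
    fix xs f assume xs: "xs \<in> inj_lists n (sum_list ?\<beta>)" and "f \<in> set (map tcyc (blocks ?\<beta> xs))"
    then obtain c where c: "c \<in> set (blocks ?\<beta> xs)" "f = tcyc c" by auto
    then have "odd (length c)" using in_blocks(3)[OF xs c(1)] odd by blast
    then show "is_hom False f" using is_hom_tcyc[of c] c(2) by (cases c) auto
  qed
  have comm: "T k * Phi (Cel n \<alpha>) = Phi (Cel n \<alpha>) * T k" if "1 \<le> k" "k < n" for k
  proof -
    have "T k * Phi (Cel n \<alpha>) * T k * T k = Phi (Cel n \<alpha>) * T k"
      unfolding Phi_Cel by (subst celop_conj) (use odd that in auto)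
    then show ?thesis by (simp add: mult.assoc)
  qed
  have "fdiff (fmul (Cel n \<alpha>) b) (fscale (ssign False q) (fmul b (Cel n \<alpha>))) \<in> rel_ideal n"
    if "is_poly n b" for b q
    using that commute_words_imp_commute_poly[OF comm that]
    by (simp add: rel_ideal_iff is_poly_fdiff is_poly_fscale is_poly_fmul is_poly_Cel
        Phi_fdiff[of n] Phi_fscale[of n] Phi_fmul[of n] ssign_def)
  then show ?thesis using hom is_poly_Cel unfolding supercentral_hom_def by blast
qed

lemma Cel_in_supercenter:
  assumes "\<alpha> \<in> odd_partitions n"
  shows "Cel n \<alpha> \<in> supercenter_pre n"
proof -
  have "fdiff (Cel n \<alpha>) (Cel n \<alpha>) \<in> rel_ideal n" using rel_ideal.zero by (simp add: fdiff_def)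
  then show ?thesis using szspan.base[OF supercentral_Cel[OF assms]] is_poly_Cel
    unfolding supercenter_pre_def by blast
qed

section \<open>Linear independence\<close>

text \<open>Powers of a cycle rotate the positions in its list, so the cycles can be recovered as
  orbits of the permutation.\<close>

lemma cperm_orbit:
  assumes d: "distinct (concat css)" and c: "c \<in> set css" "x \<in> set c"
  shows "range (\<lambda>m. (cperm css ^^ m) x) = set c"
proof -
  have pow: "(cperm css ^^ m) y = (cycle_of_list c ^^ m) y \<and> (cycle_of_list c ^^ m) y \<in> set c"
    if "y \<in> set c" for m y
  proof (induction m)
    case (Suc m)
    then show ?case using cperm_inside[OF d c(1), of "(cycle_of_list c ^^ m) y"] 
        cycle_of_list_in_set[of "(cycle_of_list c ^^ m) y" c] by simp
  qed (use that in simp)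
  have dc: "distinct c" using d c(1) by (auto simp: distinct_concat_iff)
  obtain i where i: "i < length c" "x = c ! i" using c(2) by (metis in_set_conv_nth)
  have rot: "(cycle_of_list c ^^ m) x = c ! ((m + i) mod length c)" for m
  proof -
    have "(cycle_of_list c ^^ m) x = map (cycle_of_list c ^^ m) c ! i" by (simp only: i(2) nth_map[OF i(1)])
    also have "\<dots> = rotate m c ! i" by (simp only: cyclic_rotation[OF dc])
    also have "\<dots> = c ! ((m + i) mod length c)" using i by (simp add: nth_rotate add.commute)
    finally show ?thesis .
  qed
  have "y \<in> range (\<lambda>m. (cperm css ^^ m) x)" if y: "y \<in> set c" for y
  proof -
    obtain j where j: "j < length c" "y = c ! j" using y by (metis in_set_conv_nth)
    \<comment> \<open>Moving from position i to position j takes j - i steps modulo the length;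
      adding the length keeps the exponent a natural number.\<close>
    have "j + (length c - i) + i = j + length c" using i(1) by linarith
    then have "(j + (length c - i) + i) mod length c = j" using j(1) by (simp only: mod_add_self2 mod_less)
    then have "(cycle_of_list c ^^ (j + (length c - i))) x = y" by (simp only: rot j(2))
    then have "y = (cperm css ^^ (j + (length c - i))) x" using pow[OF c(2), of "j + (length c - i)"] by argo
    then show ?thesis by (rule range_eqI)
  qed
  moreover have "(cperm css ^^ m) x \<in> set c" for m using pow[OF c(2), of m] by simp
  ultimately show ?thesis by blast
qed

lemma cycle_moves: "distinct c \<Longrightarrow> 2 \<le> length c \<Longrightarrow> x \<in> set c \<Longrightarrow> cycle_of_list c x \<noteq> x"
proof -
  assume c: "distinct c" "2 \<le> length c" "x \<in> set c"
  then obtain i where i: "i < length c" "x = c ! i" by (metis in_set_conv_nth)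
  have "cycle_of_list c x = map (cycle_of_list c ^^ 1) c ! i" using i by simp
  also have "\<dots> = rotate 1 c ! i" by (simp only: cyclic_rotation[OF c(1)])
  also have "\<dots> = c ! (Suc i mod length c)" using nth_rotate[OF i(1), of 1] by simp
  finally have eq: "cycle_of_list c x = c ! (Suc i mod length c)" .
  have "Suc i mod length c \<noteq> i" using c(2) i(1)
    by (cases "Suc i = length c") auto
  moreover have "Suc i mod length c < length c" using i(1) by (intro mod_less_divisor) linarith
  ultimately have "c ! (Suc i mod length c) \<noteq> c ! i" using c(1) i(1) by (simp add: nth_eq_iff_index_eq)
  then show ?thesis using eq i(2) by simp
qed

text \<open>The right side mentions the permutation alone, so the permutation determines the
  lengths. Length at least 2 makes every listed point move; disjointness then gives different cycles
  different nonempty sets, each counted once by \<open>mset_set\<close>.\<close>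

lemma cycle_type_mset:
  assumes d: "distinct (concat css)" and len: "\<And>c. c \<in> set css \<Longrightarrow> 2 \<le> length c"
  shows "mset (map length css)
    = image_mset card (mset_set ((\<lambda>x. range (\<lambda>m. (cperm css ^^ m) x)) ` {x. cperm css x \<noteq> x}))"
proof -
  let ?O = "\<lambda>x. range (\<lambda>m. (cperm css ^^ m) x)"
  have moved: "{x. cperm css x \<noteq> x} = set (concat css)"
  proof (intro set_eqI iffI)
    fix x assume "x \<in> set (concat css)"
    then obtain c where c: "c \<in> set css" "x \<in> set c" by auto
    then have "distinct c" using d by (auto simp: distinct_concat_iff)
    then show "x \<in> {x. cperm css x \<noteq> x}"
      using cycle_moves[of c x] len c by (simp add: cperm_inside[OF d c])
  qed (use cperm_outside in blast)
  have "?O ` {x. cperm css x \<noteq> x} = set ` set css"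
  proof (intro set_eqI iffI)
    fix Y assume "Y \<in> ?O ` {x. cperm css x \<noteq> x}"
    then obtain x c where "Y = ?O x" "c \<in> set css" "x \<in> set c" unfolding moved by auto
    then show "Y \<in> set ` set css" using cperm_orbit[OF d] by auto
  next
    fix Y assume "Y \<in> set ` set css"
    then obtain c where c: "c \<in> set css" "Y = set c" by auto
    then obtain x where x: "x \<in> set c" using len[of c] by (metis length_greater_0_conv nth_mem not_numeral_le_zero gr0I)
    then have "x \<in> {x. cperm css x \<noteq> x}" unfolding moved using c by auto
    then show "Y \<in> ?O ` {x. cperm css x \<noteq> x}" using cperm_orbit[OF d c(1) x] c(2) by blast
  qed
  moreover have "mset (map length css) = image_mset card (mset_set (set ` set css))"
    using d len
  proof (induction css)
    case (Cons c css)
    have "set c \<notin> set ` set css"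
    proof
      assume "set c \<in> set ` set css"
      then obtain b where "b \<in> set css" "set c = set b" by auto
      moreover have "set c \<inter> set b = {}" using Cons.prems(1) \<open>b \<in> set css\<close> by auto
      ultimately show False using Cons.prems(2)[of c] by auto
    qed
    then show ?case using Cons by (simp add: distinct_card)
  qed simp
  ultimately show ?thesis by simp
qed

section \<open>Partitions recovered from their parts different from 1\<close>

lemma sorted_desc_unique:
  assumes "sorted_wrt (\<lambda>x y. x \<ge> y) \<alpha>" "sorted_wrt (\<lambda>x y. x \<ge> y) \<beta>" "mset \<alpha> = mset (\<beta> :: nat list)"
  shows "\<alpha> = \<beta>"
proof -
  have "sorted (rev \<alpha>)" "sorted (rev \<beta>)" using assms by (simp_all add: sorted_wrt_rev)
  then have "rev \<alpha> = rev \<beta>" using assms(3) by (metis mset_rev properties_for_sort)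
  then show ?thesis by simp
qed

text \<open>The number of parts 1 is n minus the sum of the other parts.\<close>

lemma odd_partition_eqI:
  assumes "\<alpha> \<in> odd_partitions n" "\<beta> \<in> odd_partitions n"
    "mset (filter (\<lambda>a. a \<noteq> 1) \<alpha>) = mset (filter (\<lambda>a. a \<noteq> 1) \<beta>)"
  shows "\<alpha> = \<beta>"
proof (rule sorted_desc_unique)
  have split: "mset \<gamma> = mset (filter (\<lambda>a. a \<noteq> 1) \<gamma>) + replicate_mset (count (mset \<gamma>) 1) 1" for \<gamma> :: "nat list"
    by (induction \<gamma>) auto
  have sum: "sum_list \<gamma> = sum_mset (mset (filter (\<lambda>a. a \<noteq> 1) \<gamma>)) + count (mset \<gamma>) 1" for \<gamma> :: "nat list"
    by (induction \<gamma>) auto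
  have "count (mset \<alpha>) 1 = count (mset \<beta>) 1"
    using sum[of \<alpha>] sum[of \<beta>] assms by (simp add: odd_partitions_def)
  then show "mset \<alpha> = mset \<beta>" using split[of \<alpha>] split[of \<beta>] assms(3) by metis
qed (use assms in \<open>auto simp: odd_partitions_def\<close>)

lemma odd_partition_ge3:
  assumes "\<alpha> \<in> odd_partitions n" "a \<in> set (filter (\<lambda>a. a \<noteq> 1) \<alpha>)"
  shows "odd a" "2 \<le> a"
proof -
  show "odd a" using assms by (auto simp: odd_partitions_def)
  then show "2 \<le> a" using assms(2) by (cases "a = 0") (auto simp: numeral_2_eq_2 not_less_eq_eq intro: ccontr)
qed

lemma sum_filter_le:
  assumes "\<alpha> \<in> odd_partitions n"
  shows "sum_list (filter (\<lambda>a. a \<noteq> 1) \<alpha>) \<le> n"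
proof -
  have "sum_list (filter Q \<gamma>) \<le> sum_list \<gamma>" for Q and \<gamma> :: "nat list" by (induction \<gamma>) auto
  then show ?thesis using assms by (auto simp: odd_partitions_def)
qed

lemma finite_odd_partitions: "finite (odd_partitions n)"
proof (rule finite_subset)
  have "length \<alpha> \<le> sum_list \<alpha>" if "\<forall>a\<in>set \<alpha>. odd a" for \<alpha> :: "nat list"
    using that by (induction \<alpha>) (auto simp: Suc_le_eq dest: odd_pos)
  moreover have "a \<le> sum_list \<alpha>" if "a \<in> set \<alpha>" for a and \<alpha> :: "nat list"
    using that by (rule member_le_sum_list) simp_all
  ultimately show "odd_partitions n \<subseteq> {xs. set xs \<subseteq> {..n} \<and> length xs \<le> n}"
    by (auto simp: odd_partitions_def)
qed (rule finite_lists_length_le, simp)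

text \<open>The matrix coefficient at \<open>vac q\<close>, with q of cycle type \<alpha>0, kills
  every other \<alpha> and is a positive count times a nonzero constant on \<alpha>0.\<close>

lemma celop_independent:
  assumes zero: "(\<Sum>\<alpha>\<in>odd_partitions n. of_c (c \<alpha>) * Phi (Cel n \<alpha>)) = 0"
    and \<alpha>0: "\<alpha>0 \<in> odd_partitions n"
  shows "c \<alpha>0 = 0"
proof -
  let ?f = "\<lambda>\<alpha>. filter (\<lambda>a. a \<noteq> 1) \<alpha>"
  let ?I = "\<lambda>\<alpha>. inj_lists n (sum_list (?f \<alpha>))"
  \<comment> \<open>A sample filling of the shape \<alpha>0 by the first points of {1..n}; it
    witnesses that the count for \<alpha>0 is positive.\<close>
  define xs0 where "xs0 = [1..<Suc (sum_list (?f \<alpha>0))]"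
  have xs0: "xs0 \<in> ?I \<alpha>0"
    using sum_filter_le[OF \<alpha>0] by (auto simp: xs0_def inj_lists_def simp del: upt_Suc)
  define q where "q = cperm (blocks (?f \<alpha>0) xs0)"
  let ?N = "\<lambda>\<alpha>. {xs \<in> ?I \<alpha>. cperm (blocks (?f \<alpha>) xs) = q}"
  have val: "ap (Phi (Cel n \<alpha>)) (vac q) ({}, id) = of_nat (card (?N \<alpha>)) * vsign (?f \<alpha>)"
    if \<alpha>: "\<alpha> \<in> odd_partitions n" for \<alpha>
  proof -
    have "ap (Phi (Cel n \<alpha>)) (vac q) ({}, id)
      = (\<Sum>xs\<in>?I \<alpha>. if cperm (blocks (?f \<alpha>) xs) = q then vsign (?f \<alpha>) else 0)"
      unfolding Phi_Cel celop_def ap_sum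
    proof (rule sum.cong[OF refl])
      fix xs assume xs: "xs \<in> ?I \<alpha>"
      have "odd (length d)" if "d \<in> set (blocks (?f \<alpha>) xs)" for d
        using in_blocks(3)[OF xs that] odd_partition_ge3(1)[OF \<alpha>] by blast
      from vac_blkop[OF blocks_inj_lists(1)[OF xs] this]
      show "ap (blkop (blocks (?f \<alpha>) xs)) (vac q) ({}, id)
         = (if cperm (blocks (?f \<alpha>) xs) = q then vsign (?f \<alpha>) else 0)"
        by (simp only: blocks_inj_lists(3)[OF xs])
    qed
    also have "\<dots> = (\<Sum>xs\<in>?N \<alpha>. vsign (?f \<alpha>))"
      by (rule sum.inter_filter[OF finite_inj_lists, symmetric])
    finally show ?thesis by simp
  qed
  have empty: "?N \<alpha> = {}" if \<alpha>: "\<alpha> \<in> odd_partitions n" "\<alpha> \<noteq> \<alpha>0" for \<alpha>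
  proof (rule ccontr)
    assume "?N \<alpha> \<noteq> {}"
    then obtain xs where xs: "xs \<in> ?I \<alpha>" "cperm (blocks (?f \<alpha>) xs) = q" by blast
    have len: "2 \<le> length d" if "\<gamma> \<in> odd_partitions n" "ys \<in> ?I \<gamma>" "d \<in> set (blocks (?f \<gamma>) ys)" for \<gamma> ys d
      using in_blocks(3)[OF that(2,3)] odd_partition_ge3(2)[OF that(1)] by blast
    have "mset (map length (blocks (?f \<alpha>) xs)) = mset (map length (blocks (?f \<alpha>0) xs0))"
      using cycle_type_mset[OF blocks_inj_lists(1)[OF xs(1)] len[OF \<alpha>(1) xs(1)]]
        cycle_type_mset[OF blocks_inj_lists(1)[OF xs0] len[OF \<alpha>0 xs0]] xs(2)
      by (simp only: q_def)
    then have "mset (?f \<alpha>) = mset (?f \<alpha>0)"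
      by (simp only: blocks_inj_lists(3)[OF xs(1)] blocks_inj_lists(3)[OF xs0])
    then show False using odd_partition_eqI[OF \<alpha>(1) \<alpha>0] \<alpha>(2) by blast
  qed
  have "0 = ap (\<Sum>\<alpha>\<in>odd_partitions n. of_c (c \<alpha>) * Phi (Cel n \<alpha>)) (vac q) ({}, id)"
    by (simp add: zero)
  also have "\<dots> = (\<Sum>\<alpha>\<in>odd_partitions n. c \<alpha> * (of_nat (card (?N \<alpha>)) * vsign (?f \<alpha>)))"
    by (simp add: ap_sum val)
  also have "\<dots> = (\<Sum>\<alpha>\<in>{\<alpha>0}. c \<alpha> * (of_nat (card (?N \<alpha>)) * vsign (?f \<alpha>)))"
  proof (rule sum.mono_neutral_right[OF finite_odd_partitions])
    show "\<forall>\<alpha>\<in>odd_partitions n - {\<alpha>0}. c \<alpha> * (of_nat (card (?N \<alpha>)) * vsign (?f \<alpha>)) = 0"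
    proof
      fix \<alpha> assume "\<alpha> \<in> odd_partitions n - {\<alpha>0}"
      then have "?N \<alpha> = {}" using empty by blast
      then show "c \<alpha> * (of_nat (card (?N \<alpha>)) * vsign (?f \<alpha>)) = 0" by (simp only: card.empty) simp
    qed
  qed (use \<alpha>0 in simp)
  finally have "c \<alpha>0 * (of_nat (card (?N \<alpha>0)) * vsign (?f \<alpha>0)) = 0" by simp
  moreover have "xs0 \<in> ?N \<alpha>0" using xs0 by (simp add: q_def)
  then have "card (?N \<alpha>0) \<noteq> 0" using finite_inj_lists by (auto simp: card_eq_0_iff)
  ultimately show ?thesis using vsign_nonzero by simp
qed

section \<open>Parities\<close>

lemma permutation_pm: "permutation (pm w)"
  by (induction w) (simp_all only: pm_simps permutation_id permutation_compose permutation_swap_id)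

lemma sign_pm: "sign (pm w) = (-1) ^ length w"
proof (induction w)
  case (Cons k w)
  have "sign (pm (k # w)) = sign (transpose k (Suc k)) * sign (pm w)"
    by (simp only: pm_simps sign_compose[OF permutation_swap_id permutation_pm])
  then show ?case using Cons by (simp add: sign_swap_id comp_def)
qed (simp only: pm_simps sign_id list.size power_0)

lemma sign_cycle: "distinct c \<Longrightarrow> sign (cycle_of_list c) = (-1) ^ (length c - 1)"
proof (induction c rule: cycle_of_list.induct)
  case (1 a b c)
  have "sign (cycle_of_list (a # b # c)) = sign (transpose a b) * sign (cycle_of_list (b # c))"
    by (simp only: cycle_of_list.simps sign_compose[OF permutation_swap_id permutation_of_cycle])
  then show ?case using 1 by (simp add: sign_swap_id comp_def)
qed (simp_all only: cycle_of_list.simps sign_id, simp_all)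

text \<open>The number of \<open>tauop\<close> factors in the cycle product; its parity is the
  degree of the product.\<close>

definition wt :: "nat list list \<Rightarrow> nat" where "wt css = (\<Sum>c\<leftarrow>css. length c - 1)"

lemma permutation_cperm: "permutation (cperm css)"
  by (induction css) (simp_all only: cperm_simps permutation_id permutation_compose permutation_of_cycle)

lemma sign_cperm: "(\<And>c. c \<in> set css \<Longrightarrow> distinct c) \<Longrightarrow> sign (cperm css) = (-1) ^ wt css"
proof (induction css)
  case Nil
  show ?case by (simp only: cperm_simps sign_id) (simp add: wt_def)
next
  case (Cons c css)
  have "sign (cperm (c # css)) = sign (cycle_of_list c) * sign (cperm css)"
    by (simp only: cperm_simps sign_compose[OF permutation_of_cycle permutation_cperm])
  also have "\<dots> = (-1) ^ (length c - 1) * (-1) ^ wt css" using Cons by (simp add: sign_cycle)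
  finally show ?case by (simp add: wt_def power_add)
qed

lemma minus_one_power_eq_iff: "(-1::int) ^ m = (-1) ^ k \<longleftrightarrow> (even m \<longleftrightarrow> even k)"
  by (cases "even m"; cases "even k") auto

text \<open>The sign of a permutation fixes the parity of every word for it.\<close>

lemma even_length_pm: "pm u = pm v \<Longrightarrow> even (length u) \<longleftrightarrow> even (length v)"
  using sign_pm[of u] sign_pm[of v] by (simp add: minus_one_power_eq_iff)

section \<open>Twisted conjugation\<close>

text \<open>\<open>rev w\<close> spells the inverse of w. With s = -1 for odd X and s = 1 for even
  X, invariance under all letters is the supercommutation rule for the generators.\<close>

definition tw :: "complex \<Rightarrow> nat list \<Rightarrow> lin \<Rightarrow> lin" where
  "tw s w X = of_c (s ^ length w) * (opw w * X * opw (rev w))"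

lemma tw_append: "tw s (u @ v) X = tw s u (tw s v X)"
  by (simp add: tw_def power_add of_c_mult mult.assoc opw_of_c_left)

lemma tw_scale: "tw s w (of_c c * X) = of_c c * tw s w X"
  by (simp add: tw_def mult.assoc opw_of_c_left) (metis mult.assoc of_c_comm)

lemma tw_sum: "tw s w (sum F A) = (\<Sum>i\<in>A. tw s w (F i))"
  by (simp add: tw_def sum_distrib_left sum_distrib_right)

text \<open>The sign between u and v occurs once in the word and once in its inverse, and s ^ length
  depends on the parity only. Twisted conjugation is thus an action of the symmetric group.\<close>

lemma tw_cong:
  assumes "s = 1 \<or> s = -1" "set u \<subseteq> {1..<n}" "set v \<subseteq> {1..<n}" "pm u = pm v"
  shows "tw s u X = tw s v X"
proof -
  obtain e where e: "e = 1 \<or> e = -1" "opw u = of_c e * opw v"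
    using E_opw[OF pm_eq_imp_E[OF assms(2,3) order_refl assms(4)] assms(3,2)] by auto
  have ee: "of_c e * (of_c e * Y) = Y" for Y using e(1) by auto
  have "opw (rev v) = opw (rev u) * (opw u * opw (rev v))"
    using opw_rev[of u] by (simp flip: mult.assoc)
  also have "\<dots> = of_c e * opw (rev u) * (opw v * opw (rev v))"
    using e(1) by (auto simp: e(2) mult.assoc)
  finally have v: "opw (rev v) = of_c e * opw (rev u)" by (simp add: opw_rev')
  have "opw v * X * opw (rev v) = of_c e * opw v * X * opw (rev u)"
    using e(1) unfolding v by (auto simp: mult.assoc)
  then have "opw u * X * opw (rev u) = opw v * X * opw (rev v)" by (simp only: e(2))
  moreover have "s ^ length u = s ^ length v"
    using even_length_pm[OF assms(4)] assms(1) by (auto simp: minus_one_power_iff)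
  ultimately show ?thesis by (simp add: tw_def)
qed

definition perms :: "nat \<Rightarrow> (nat \<Rightarrow> nat) set" where "perms n = {q. q permutes {1..n}}"

definition rep :: "nat \<Rightarrow> (nat \<Rightarrow> nat) \<Rightarrow> nat list" where
  "rep n q = (SOME w. set w \<subseteq> {1..<n} \<and> pm w = q)"

lemma rep: "q \<in> perms n \<Longrightarrow> set (rep n q) \<subseteq> {1..<n} \<and> pm (rep n q) = q"
  unfolding rep_def perms_def by (rule someI_ex, rule permutes_word) simp

lemma finite_perms: "finite (perms n)"
  by (simp add: perms_def finite_permutations)

definition avg :: "nat \<Rightarrow> complex \<Rightarrow> lin \<Rightarrow> lin" where
  "avg n s X = (\<Sum>q\<in>perms n. tw s (rep n q) X)"

lemma avg_scale: "avg n s (of_c c * X) = of_c c * avg n s X"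
  by (simp add: avg_def tw_scale sum_distrib_left)

lemma avg_sum: "avg n s (sum F A) = (\<Sum>i\<in>A. avg n s (F i))"
  unfolding avg_def tw_sum by (rule sum.swap)

text \<open>Twisting by g first amounts to right translation of the summation index by
  \<open>pm g\<close>.\<close>

lemma avg_tw:
  assumes "s = 1 \<or> s = -1" "set g \<subseteq> {1..<n}"
  shows "avg n s (tw s g X) = avg n s X"
proof -
  have g: "pm g permutes {1..n}" by (rule pm_permutes[OF assms(2)])
  have "avg n s (tw s g X) = (\<Sum>q\<in>perms n. tw s (rep n (q \<circ> pm g)) X)"
    unfolding avg_def
  proof (rule sum.cong[OF refl])
    fix q assume q: "q \<in> perms n"
    then have "q \<circ> pm g \<in> perms n" using g by (simp only: perms_def mem_Collect_eq permutes_compose)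
    note r = rep[OF this] rep[OF q]
    show "tw s (rep n q) (tw s g X) = tw s (rep n (q \<circ> pm g)) X"
      unfolding tw_append[symmetric]
      by (rule tw_cong[OF assms(1), where n = n]) (use r assms(2) in \<open>simp_all only: set_append Un_subset_iff pm_append\<close>)
  qed
  also have "\<dots> = avg n s X"
    unfolding avg_def
  proof (rule sum.reindex_bij_witness[of _ "\<lambda>q. q \<circ> inv (pm g)" "\<lambda>q. q \<circ> pm g"])
    fix q assume q: "q \<in> perms n"
    show "q \<circ> pm g \<circ> inv (pm g) = q" "q \<circ> inv (pm g) \<circ> pm g = q"
      using permutes_inv_o[OF g] by (simp_all only: comp_assoc comp_id)
    show "q \<circ> pm g \<in> perms n" "q \<circ> inv (pm g) \<in> perms n"
      using q g permutes_inv[OF g] by (simp_all only: perms_def mem_Collect_eq permutes_compose)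
  qed simp
  finally show ?thesis .
qed

lemma tauop_cycop_comm:
  assumes "a \<noteq> b" "a \<notin> set d" "b \<notin> set d" "distinct d"
  shows "tauop a b * cycop d = of_c ((-1) ^ (length d - 1)) * (cycop d * tauop a b)"
  using assms
proof (induction d rule: cycop.induct)
  case (1 x y d)
  have "tauop a b * tauop x y = - (tauop x y * tauop a b)"
    using 1 by (intro tauop_anti) auto
  then have "tauop a b * cycop (x # y # d) = - (tauop x y * (tauop a b * cycop (y # d)))"
    by (simp flip: mult.assoc)
  also have "tauop a b * cycop (y # d) = of_c ((-1) ^ length d) * (cycop (y # d) * tauop a b)"
    using 1 by simp
  finally show ?case by (simp add: mult.assoc of_c_left_comm[of "tauop x y"])
qed simp_all

lemma tauop_blkop_comm:
  assumes "a \<noteq> b" "a \<notin> set (concat css)" "b \<notin> set (concat css)" "distinct (concat css)"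
  shows "tauop a b * blkop css = of_c ((-1) ^ wt css) * (blkop css * tauop a b)"
  using assms
proof (induction css)
  case (Cons c css)
  have "tauop a b * blkop (c # css) = (tauop a b * cycop c) * blkop css" by (simp add: mult.assoc)
  also have "\<dots> = of_c ((-1) ^ (length c - 1)) * (cycop c * (tauop a b * blkop css))"
    using Cons tauop_cycop_comm[of a b c] by (simp add: mult.assoc)
  also have "tauop a b * blkop css = of_c ((-1) ^ wt css) * (blkop css * tauop a b)"
    using Cons by simp
  finally show ?case by (simp add: wt_def power_add of_c_mult mult.assoc of_c_left_comm[of "cycop c"])
qed (simp add: wt_def)

text \<open>Each of the \<open>length c - 1\<close> factors of the cycle passes all
  \<open>wt css\<close> factors of the product, with one sign -1 per crossing.\<close>

lemma cycop_blkop_comm: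
  assumes "distinct c" "set c \<inter> set (concat css) = {}" "distinct (concat css)"
  shows "cycop c * blkop css = of_c (((-1) ^ wt css) ^ (length c - 1)) * (blkop css * cycop c)"
  using assms
proof (induction c rule: cycop.induct)
  case (1 a b c)
  let ?e = "of_c ((-1) ^ wt css)" and ?d = "of_c (((-1) ^ wt css) ^ length c)"
  have "cycop (a # b # c) * blkop css = tauop a b * (cycop (b # c) * blkop css)"
    by (simp add: mult.assoc)
  also have "cycop (b # c) * blkop css = ?d * (blkop css * cycop (b # c))"
    using 1 by simp
  also have "tauop a b * (?d * (blkop css * cycop (b # c))) = ?d * ((tauop a b * blkop css) * cycop (b # c))"
    by (simp only: of_c_left_comm[of "tauop a b"] mult.assoc)
  also have "tauop a b * blkop css = ?e * (blkop css * tauop a b)"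
    by (rule tauop_blkop_comm) (use 1 in auto)
  finally have "cycop (a # b # c) * blkop css = ?d * ?e * (blkop css * cycop (a # b # c))"
    by (simp add: mult.assoc)
  moreover have "?d * ?e = of_c (((-1) ^ wt css) ^ (length (a # b # c) - 1))"
    unfolding of_c_mult[symmetric] by (simp add: mult.commute)
  ultimately show ?case by (simp only:)
qed simp_all

text \<open>An even cycle is an odd invertible element which commutes with itself instead of
  supercommuting; hence twisted conjugation by it negates the product.\<close>
lemma avg_even_cycle:
  assumes d: "distinct (concat css)" "set (concat css) \<subseteq> {1..n}"
    and c: "c \<in> set css" "even (length c)" "c \<noteq> []"
    and s: "s = (-1) ^ wt css"
    and u: "set u \<subseteq> {1..<n}" "pm u = cperm css"
  shows "avg n s (opw u) = 0"
proof -
  let ?r = "remove1 c css"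
  have m: "mset css = mset (c # ?r)" using c(1) by simp
  have d': "distinct (concat (c # ?r))" using d(1) distinct_concat_mset[OF m] by blast
  have set_r: "set (concat (c # ?r)) \<subseteq> {1..n}" using d(2) c(1) set_remove1_subset[of c css] by auto
  have dc: "distinct c" "set c \<subseteq> {1..n}" using d' set_r by auto
  let ?B = "cycop c" and ?Y = "blkop ?r"
  have cp: "pm u = cperm (c # ?r)" using cperm_mset[OF m d(1)] u(2) by simp
  obtain e where e: "e = 1 \<or> e = -1" "opw u = of_c e * (?B * ?Y)"
    using opw_eq_blkop[OF u(1) cp d' set_r] by auto
  obtain g k where g: "set g \<subseteq> {1..<n}" "k = 1 \<or> k = -1" "?B = of_c k * opw g" "pm g = cycle_of_list c"
    using is_word_cycop[OF dc] unfolding is_word_def by metis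
  have "odd (length c - 1)" using c(2,3) by (cases c) auto
  have "(-1::int) ^ length g = (-1) ^ (length c - 1)"
    using sign_pm[of g] sign_cycle[OF dc(1)] g(4) by simp
  then have "odd (length g)" using \<open>odd (length c - 1)\<close> by (simp add: minus_one_power_eq_iff)
  have s1: "s = 1 \<or> s = -1" unfolding s by (cases "even (wt css)") auto
  have wt: "wt css = (length c - 1) + wt ?r"
    using m by (simp add: wt_def flip: sum_mset_sum_list) 
      (metis (no_types, lifting) image_mset_add_mset sum_mset.add_mset)
  \<comment> \<open>The cycle has odd degree, so the sign for exchanging it with the remaining
    product is -s. Conjugation gives this sign, and the twist s turns it into -1.\<close>
  have "s = - ((-1) ^ wt ?r)" unfolding s wt power_add using \<open>odd (length c - 1)\<close> by simp
  then have "(-1) ^ wt ?r = - s" by simp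
  moreover have "((-1::complex) ^ wt ?r) ^ (length c - 1) = (-1) ^ wt ?r"
    using \<open>odd (length c - 1)\<close> by (cases "even (wt ?r)") auto
  ultimately have BY: "?B * ?Y = of_c (- s) * (?Y * ?B)"
    using cycop_blkop_comm[of c ?r] d' by simp
  have gB: "opw g = of_c k * ?B" using g(2,3) by auto
  have "opw g * (?B * ?Y) = of_c (- s) * ((?B * ?Y) * opw g)"
  proof -
    have "opw g * (?B * ?Y) = of_c k * (?B * (of_c (- s) * (?Y * ?B)))"
      by (simp only: gB BY mult.assoc)
    also have "\<dots> = of_c (- s) * ((?B * ?Y) * (of_c k * ?B))"
      using g(2) by (auto simp: mult.assoc of_c_left_comm[of ?B])
    finally show ?thesis by (simp only: gB)
  qed
  then have "opw g * (?B * ?Y) * opw (rev g) = of_c (- s) * ((?B * ?Y) * (opw g * opw (rev g)))"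
    by (simp only: mult.assoc)
  then have "opw g * (?B * ?Y) * opw (rev g) = of_c (- s) * (?B * ?Y)" by (simp add: opw_rev')
  moreover have "s ^ length g = s" using s1 \<open>odd (length g)\<close> by auto
  ultimately have "tw s g (?B * ?Y) = of_c (s * (- s)) * (?B * ?Y)"
    by (simp add: tw_def of_c_mult mult.assoc)
  also have "s * (- s) = -1" using s1 by auto
  finally have neg: "tw s g (?B * ?Y) = of_c (-1) * (?B * ?Y)" .
  have "of_c (-1) * avg n s (?B * ?Y) = avg n s (?B * ?Y)"
    using avg_tw[OF s1 g(1), of "?B * ?Y"] by (simp only: neg avg_scale)
  moreover have "X + X = 0" if "of_c (-1) * X = X" for X
  proof -
    have "X + X = of_c (-1) * X + X" by (simp only: that)
    then show ?thesis by simp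
  qed
  ultimately have "avg n s (?B * ?Y) + avg n s (?B * ?Y) = 0" by blast
  \<comment> \<open>\<open>lin\<close> is known only as a ring; the factor 2 is removed by the
    scalar 1/2.\<close>
  then have "of_c (1/2) * (of_c 2 * avg n s (?B * ?Y)) = 0"
    by (simp add: of_c_numeral mult_2)
  then have "avg n s (?B * ?Y) = 0" by (simp flip: mult.assoc of_c_mult)
  then show ?thesis by (simp only: e(2) avg_scale mult_zero_right)
qed

section \<open>Averages of products of odd cycles\<close>

text \<open>Given q for the tails, composing with the transposition of q x and y corrects the value
  at x and fixes the values already matched.\<close>

lemma extend_to_perm:
  assumes "distinct xs" "distinct ys" "length xs = length ys" "set xs \<subseteq> {1..n}" "set ys \<subseteq> {1..n}"
  shows "\<exists>q\<in>perms n. map q xs = ys"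
  using assms
proof (induction xs arbitrary: ys)
  case Nil
  then show ?case by (intro bexI[of _ id]) (auto simp: perms_def permutes_id)
next
  case (Cons x xs)
  then obtain y zs where ys: "ys = y # zs" by (cases ys) auto
  obtain q where q: "q permutes {1..n}" "map q xs = zs"
    using Cons.IH[of zs] Cons.prems ys by (auto simp: perms_def)
  have "q x \<in> {1..n}" using permutes_in_image[OF q(1)] Cons.prems by simp
  then have "transpose (q x) y permutes {1..n}"
    by (rule permutes_swap_id) (use Cons.prems ys in auto)
  then have "transpose (q x) y \<circ> q \<in> perms n"
    using q(1) by (simp only: perms_def mem_Collect_eq permutes_compose)
  moreover have "map (transpose (q x) y \<circ> q) xs = zs"
  proof -
    have "transpose (q x) y (q z) = q z" if "z \<in> set xs" for z
    proof -
      have "q z \<noteq> q x" using permutes_inj[OF q(1)] that Cons.prems by (auto dest: injD)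
      moreover have "q z \<noteq> y" using that q(2) Cons.prems ys by auto
      ultimately show ?thesis by (simp add: transpose_def)
    qed
    then show ?thesis using q(2) by auto
  qed
  ultimately show ?case using ys by (intro bexI[of _ "transpose (q x) y \<circ> q"]) auto
qed

text \<open>The fibres of q -> \<open>map q xs\<close> are the left cosets of the stabiliser of xs,
  so all have the same size k.\<close>

lemma sum_perms_map:
  fixes F :: "nat list \<Rightarrow> lin"
  assumes "xs \<in> inj_lists n m"
  shows "\<exists>k. (\<Sum>q\<in>perms n. F (map q xs)) = of_c (of_nat k) * (\<Sum>ys\<in>inj_lists n m. F ys)"
proof -
  let ?fib = "\<lambda>ys. {q \<in> perms n. map q xs = ys}"
  have img: "map q xs \<in> inj_lists n m" if "q \<in> perms n" for q
  proof -
    have q: "q permutes {1..n}" using that by (simp add: perms_def)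
    have "distinct (map q xs)"
      using assms permutes_inj_on[OF q, of "set xs"] by (simp add: inj_lists_def distinct_map)
    moreover have "q ` set xs \<subseteq> {1..n}"
      using assms permutes_image[OF q] unfolding inj_lists_def by blast
    ultimately show ?thesis using assms by (simp add: inj_lists_def)
  qed
  have card: "card (?fib ys) = card (?fib xs)" if ys: "ys \<in> inj_lists n m" for ys
  proof -
    obtain q0 where q0: "q0 \<in> perms n" "map q0 xs = ys"
      using extend_to_perm[of xs ys n] assms ys by (auto simp: inj_lists_def)
    then have p0: "q0 permutes {1..n}" by (simp add: perms_def)
    have inv: "inv q0 (q0 z) = z" "q0 (inv q0 z) = z" for z using permutes_inverses[OF p0] by simp_all
    have "bij_betw (\<lambda>q. q0 \<circ> q) (?fib xs) (?fib ys)"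
    proof (rule bij_betw_byWitness[of _ "\<lambda>q. inv q0 \<circ> q"])
      show "\<forall>q\<in>?fib xs. inv q0 \<circ> (q0 \<circ> q) = q" "\<forall>q\<in>?fib ys. q0 \<circ> (inv q0 \<circ> q) = q"
        by (auto simp: fun_eq_iff inv)
      show "(\<lambda>q. q0 \<circ> q) ` ?fib xs \<subseteq> ?fib ys"
      proof safe
        fix q assume "q \<in> perms n" "map q xs = xs"
        then show "q0 \<circ> q \<in> perms n"
          using p0 by (simp only: perms_def mem_Collect_eq permutes_compose)
        have "map (q0 \<circ> q) xs = map q0 (map q xs)" by simp
        then show "map (q0 \<circ> q) xs = ys" using \<open>map q xs = xs\<close> q0(2) by simp
      qed
      show "(\<lambda>q. inv q0 \<circ> q) ` ?fib ys \<subseteq> ?fib xs"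
      proof safe
        fix q assume q: "q \<in> perms n" "ys = map q xs"
        then show "inv q0 \<circ> q \<in> perms n"
          using permutes_inv[OF p0] by (simp only: perms_def mem_Collect_eq permutes_compose)
        have "map (inv q0 \<circ> q) xs = map (inv q0) (map q xs)" by simp
        also have "\<dots> = map (inv q0) (map q0 xs)" using q q0(2) by simp
        also have "\<dots> = xs" by (simp add: inv o_def)
        finally show "map (inv q0 \<circ> q) xs = xs" .
      qed
    qed
    then show ?thesis by (simp add: bij_betw_same_card)
  qed
  have "(\<Sum>q\<in>perms n. F (map q xs)) = (\<Sum>ys\<in>inj_lists n m. \<Sum>q\<in>?fib ys. F (map q xs))"
    by (rule sum.group[symmetric]) (use finite_perms finite_inj_lists img in auto)
  also have "\<dots> = (\<Sum>ys\<in>inj_lists n m. of_c (of_nat (card (?fib xs))) * F ys)"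
  proof (rule sum.cong[OF refl])
    fix ys assume ys: "ys \<in> inj_lists n m"
    have "(\<Sum>q\<in>?fib ys. F (map q xs)) = (\<Sum>q\<in>?fib ys. of_c 1 * F ys)"
      by (rule sum.cong) auto
    also have "\<dots> = of_c (\<Sum>q\<in>?fib ys. 1) * F ys" by (simp only: of_c_sum sum_distrib_right)
    finally show "(\<Sum>q\<in>?fib ys. F (map q xs)) = of_c (of_nat (card (?fib xs))) * F ys"
      using card[OF ys] by simp
  qed
  finally show ?thesis by (intro exI[of _ "card (?fib xs)"]) (simp only: sum_distrib_left)
qed

definition celspan :: "nat \<Rightarrow> lin set" where
  "celspan n = {X. \<exists>c. X = (\<Sum>\<alpha>\<in>odd_partitions n. of_c (c \<alpha>) * Phi (Cel n \<alpha>))}"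

lemma celspan_zero: "0 \<in> celspan n"
  unfolding celspan_def by (auto intro!: exI[of _ "\<lambda>_. 0"])

lemma celspan_add: "X \<in> celspan n \<Longrightarrow> Y \<in> celspan n \<Longrightarrow> X + Y \<in> celspan n"
proof -
  assume "X \<in> celspan n" "Y \<in> celspan n"
  then obtain c d where "X = (\<Sum>\<alpha>\<in>odd_partitions n. of_c (c \<alpha>) * Phi (Cel n \<alpha>))"
     "Y = (\<Sum>\<alpha>\<in>odd_partitions n. of_c (d \<alpha>) * Phi (Cel n \<alpha>))" by (auto simp: celspan_def)
  then have "X + Y = (\<Sum>\<alpha>\<in>odd_partitions n. of_c (c \<alpha> + d \<alpha>) * Phi (Cel n \<alpha>))"
    by (simp add: of_c_add distrib_right sum.distrib)
  then show ?thesis unfolding celspan_def mem_Collect_eq by (rule exI[of _ "\<lambda>\<alpha>. c \<alpha> + d \<alpha>"])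
qed

lemma celspan_scale: "X \<in> celspan n \<Longrightarrow> of_c k * X \<in> celspan n"
proof -
  assume "X \<in> celspan n"
  then obtain c where "X = (\<Sum>\<alpha>\<in>odd_partitions n. of_c (c \<alpha>) * Phi (Cel n \<alpha>))" by (auto simp: celspan_def)
  then have "of_c k * X = (\<Sum>\<alpha>\<in>odd_partitions n. of_c (k * c \<alpha>) * Phi (Cel n \<alpha>))"
    by (simp add: of_c_mult mult.assoc sum_distrib_left)
  then show ?thesis unfolding celspan_def mem_Collect_eq by (rule exI[of _ "\<lambda>\<alpha>. k * c \<alpha>"])
qed

lemma celspan_sum: "(\<And>i. i \<in> A \<Longrightarrow> F i \<in> celspan n) \<Longrightarrow> sum F A \<in> celspan n"
  by (induction A rule: infinite_finite_induct) (auto intro: celspan_zero celspan_add)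

lemma celspan_Cel: "\<alpha> \<in> odd_partitions n \<Longrightarrow> Phi (Cel n \<alpha>) \<in> celspan n"
proof -
  assume a: "\<alpha> \<in> odd_partitions n"
  have "(\<Sum>\<beta>\<in>odd_partitions n. of_c (if \<beta> = \<alpha> then 1 else 0) * Phi (Cel n \<beta>))
     = (\<Sum>\<beta>\<in>odd_partitions n. if \<beta> = \<alpha> then Phi (Cel n \<beta>) else 0)"
    by (rule sum.cong) auto
  also have "\<dots> = Phi (Cel n \<alpha>)" using a finite_odd_partitions by simp
  finally show ?thesis unfolding celspan_def mem_Collect_eq by (intro exI) (rule sym)
qed

text \<open>For odd cycles untwisted conjugation is mere renaming, so the average runs over all
  fillings of the same shape with constant multiplicity.\<close>

lemma avg_odd_cycles:
  assumes d: "distinct (concat css)" "set (concat css) \<subseteq> {1..n}"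
    and odd: "\<And>c. c \<in> set css \<Longrightarrow> odd (length c) \<and> 2 \<le> length c"
    and u: "set u \<subseteq> {1..<n}" "pm u = cperm css"
  shows "avg n 1 (opw u) \<in> celspan n"
proof -
  \<comment> \<open>Sorting by decreasing length and padding with parts 1 for the fixed points turns
    the cycle lengths into a partition of n.\<close>
  define ds where "ds = rev (sort_key length css)"
  define \<beta> where "\<beta> = map length ds"
  define \<alpha> where "\<alpha> = \<beta> @ replicate (n - sum_list \<beta>) 1"
  have m: "mset css = mset ds" by (simp add: ds_def)
  have d': "distinct (concat ds)" using d(1) distinct_concat_mset[OF m] by blast
  have set_ds: "set (concat ds) \<subseteq> {1..n}" using d(2) mset_eq_setD[OF m] by simp
  have odd': "odd (length c) \<and> 2 \<le> length c" if "c \<in> set ds" for c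
    using that odd mset_eq_setD[OF m] by blast
  have dc: "distinct c" if "c \<in> set ds" for c using that d' by (auto simp: distinct_concat_iff)
  have len: "sum_list \<beta> = length (concat ds)" by (simp add: \<beta>_def length_concat)
  also have "\<dots> \<le> n" using card_mono[OF _ set_ds] distinct_card[OF d'] by simp
  finally have le: "sum_list \<beta> \<le> n" .
  have \<beta>2: "odd a \<and> 2 \<le> a" if "a \<in> set \<beta>" for a using that odd' by (auto simp: \<beta>_def)
  have "sorted_wrt (\<lambda>x y. x \<ge> y) \<beta>"
    by (simp add: \<beta>_def ds_def rev_map[symmetric] sorted_wrt_rev)
  then have \<alpha>: "\<alpha> \<in> odd_partitions n"
    using \<beta>2 le by (auto simp: odd_partitions_def \<alpha>_def sorted_wrt_append sum_list_replicate
        sorted_wrt_iff_nth_less[of _ "replicate _ _"] dest!: \<beta>2)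
  have "filter (\<lambda>a. a \<noteq> 1) \<beta> = \<beta>" using \<beta>2 by (intro filter_True) fastforce
  moreover have "filter (\<lambda>a. a \<noteq> 1) (replicate k (1::nat)) = []" for k by (induction k) auto
  ultimately have f: "filter (\<lambda>a. a \<noteq> 1) \<alpha> = \<beta>" by (simp only: \<alpha>_def filter_append append_Nil2)
  have xs: "concat ds \<in> inj_lists n (sum_list \<beta>)"
    using d' set_ds len by (simp add: inj_lists_def)
  obtain e where e: "opw u = of_c e * blkop ds"
    using opw_eq_blkop[OF u(1) _ d' set_ds] u(2) cperm_mset[OF m d(1)] by auto
  have "avg n 1 (blkop ds) = (\<Sum>q\<in>perms n. blkop (blocks \<beta> (map q (concat ds))))"
    unfolding avg_def
  proof (rule sum.cong[OF refl])
    fix q assume q: "q \<in> perms n"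
    have "tw 1 (rep n q) (blkop ds) = opw (rep n q) * blkop ds * opw (rev (rep n q))"
      by (simp add: tw_def)
    also have "\<dots> = blkop (map (map (pm (rep n q))) ds)"
      by (rule blkop_conj_word) (use dc odd' in blast)
    also have "map (map (pm (rep n q))) ds = blocks \<beta> (map q (concat ds))"
      using rep[OF q] by (simp only: blocks_map blocks_concat \<beta>_def)
    finally show "tw 1 (rep n q) (blkop ds) = blkop (blocks \<beta> (map q (concat ds)))" .
  qed
  also obtain k where "\<dots> = of_c (of_nat k) * (\<Sum>ys\<in>inj_lists n (sum_list \<beta>). blkop (blocks \<beta> ys))"
    using sum_perms_map[OF xs, of "\<lambda>ys. blkop (blocks \<beta> ys)"] by blast
  also have "\<dots> = of_c (of_nat k) * Phi (Cel n \<alpha>)" by (simp only: Phi_Cel f celop_def)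
  finally have "avg n 1 (blkop ds) \<in> celspan n"
    using celspan_scale[OF celspan_Cel[OF \<alpha>]] by simp
  then show ?thesis unfolding e avg_scale by (rule celspan_scale)
qed

text \<open>The parity of u equals that of its cycle product, so the twist is the one required by
  \<open>avg_even_cycle\<close>; without even cycles it is 1.\<close>

lemma avg_in_celspan:
  assumes "set u \<subseteq> {1..<n}"
  shows "avg n ((-1) ^ length u) (opw u) \<in> celspan n"
proof -
  obtain css where css: "cperm css = pm u" "distinct (concat css)" "set (concat css) \<subseteq> {1..n}"
    "\<And>c. c \<in> set css \<Longrightarrow> 2 \<le> length c"
    using permutes_cycles[OF pm_permutes[OF assms]] by metis
  have "(-1::int) ^ length u = (-1) ^ wt css"
    using sign_pm[of u] sign_cperm[of css] css(1,2) by (simp add: distinct_concat_iff)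
  then have par: "even (length u) \<longleftrightarrow> even (wt css)" by (simp only: minus_one_power_eq_iff)
  then have s: "(-1::complex) ^ length u = (-1) ^ wt css" by (auto simp: minus_one_power_iff)
  show ?thesis
  proof (cases "\<exists>c\<in>set css. even (length c)")
    case True
    then obtain c where c: "c \<in> set css" "even (length c)" by blast
    then have "c \<noteq> []" using css(4)[OF c(1)] by auto
    then have "avg n ((-1) ^ length u) (opw u) = 0"
      using avg_even_cycle[OF css(2,3) c _ s assms] css(1) by simp
    then show ?thesis by (simp add: celspan_zero)
  next
    case False
    then have odd: "odd (length c) \<and> 2 \<le> length c" if "c \<in> set css" for c using that css(4) by blast
    have "even (wt css)" unfolding wt_def using False by (induction css) auto
    then have "(-1::complex) ^ length u = 1" using s by simp
    then show ?thesis using avg_odd_cycles[OF css(2,3) odd assms] css(1) by simp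
  qed
qed

section \<open>The supercenter is spanned by the elements Cel\<close>

text \<open>Supercommutation with letters fixes \<open>Phi a\<close> under every twisted
  conjugation, so its average is n! times itself. Homogeneity gives all words of a the sign s, so
  the average may be taken word by word.\<close>

lemma supercentral_in_celspan:
  assumes "supercentral_hom n a"
  shows "Phi a \<in> celspan n"
proof -
  obtain p where a: "is_poly n a" "is_hom p a"
    and comm: "\<And>b q. is_poly n b \<Longrightarrow> is_hom q b \<Longrightarrow>
           fdiff (fmul a b) (fscale (ssign p q) (fmul b a)) \<in> rel_ideal n"
    using assms unfolding supercentral_hom_def by blast
  define s where "s = ssign p True"
  have s: "s = 1 \<or> s = -1" by (simp add: s_def ssign_def)
  have tw_letter: "tw s [k] (Phi a) = Phi a" if k: "1 \<le> k" "k < n" for k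
  proof -
    have poly: "is_poly n (fword [k])" using k by (intro is_poly_fword) auto
    have "is_hom True (fword [k])" using is_hom_fword[of "[k]"] by simp
    from rel_ideal_Phi[OF comm[OF poly this]]
    have "Phi a * T k = of_c s * (T k * Phi a)"
      using poly a(1) by (simp add: Phi_fdiff[of n] Phi_fscale[of n] Phi_fmul[of n] is_poly_fmul is_poly_fscale s_def)
    then have "T k * (Phi a * T k) = of_c s * Phi a"
      using s by auto
    then show ?thesis using s by (auto simp: tw_def mult.assoc)
  qed
  have tw_word: "tw s w (Phi a) = Phi a" if "set w \<subseteq> {1..<n}" for w
    using that
  proof (induction w)
    case (Cons k w)
    then show ?case using tw_append[of s "[k]" w] tw_letter[of k] by simp
  qed (simp add: tw_def)
  have "avg n s (Phi a) = (\<Sum>q\<in>perms n. of_c 1 * Phi a)"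
    unfolding avg_def by (rule sum.cong) (use rep tw_word in auto)
  also have "\<dots> = of_c (of_nat (card (perms n))) * Phi a"
    by (simp only: of_c_sum[symmetric] sum_distrib_right[symmetric]) simp
  finally have avg1: "avg n s (Phi a) = of_c (of_nat (card (perms n))) * Phi a" .
  have "avg n s (Phi a) \<in> celspan n"
    unfolding Phi_def avg_sum avg_scale
  proof (intro celspan_sum celspan_scale)
    fix u assume "u \<in> {u. a u \<noteq> 0}"
    then have u: "set u \<subseteq> {1..<n}" "odd (length u) = p"
      using a by (auto simp: is_poly_def is_hom_def)
    then have "s = (-1) ^ length u" by (auto simp: s_def ssign_def)
    then show "avg n s (opw u) \<in> celspan n" using avg_in_celspan[OF u(1)] by simp
  qed
  \<comment> \<open>\<open>avg\<close> is an undivided sum over the group; the division by n!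
    happens here.\<close>
  then have "of_c (1 / of_nat (card (perms n))) * avg n s (Phi a) \<in> celspan n" by (rule celspan_scale)
  moreover have "card (perms n) \<noteq> 0" by (simp add: perms_def card_permutations)
  ultimately show ?thesis by (simp add: avg1 flip: mult.assoc of_c_mult)
qed

lemma szspan_in_celspan: "x \<in> szspan n \<Longrightarrow> is_poly n x \<and> Phi x \<in> celspan n"
proof (induction rule: szspan.induct)
  case (base a)
  then show ?case using supercentral_in_celspan by (simp add: supercentral_hom_def)
qed (auto simp: is_poly_zero is_poly_fadd is_poly_fscale Phi_fadd Phi_fscale celspan_zero celspan_add celspan_scale)

lemma is_poly_Cel_combination: "is_poly n (fsum (\<lambda>\<alpha>. fscale (c \<alpha>) (Cel n \<alpha>)) S)"
  by (intro is_poly_fsum is_poly_fscale is_poly_Cel)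

lemma Phi_Cel_combination:
  "Phi (fsum (\<lambda>\<alpha>. fscale (c \<alpha>) (Cel n \<alpha>)) S) = (\<Sum>\<alpha>\<in>S. of_c (c \<alpha>) * Phi (Cel n \<alpha>))"
  using is_poly_Cel by (simp add: Phi_fsum[of S n] Phi_fscale[of n] is_poly_fscale)

theorem mainTheorem15:
  fixes n :: nat
  shows "(\<forall>\<alpha>\<in>odd_partitions n. Cel n \<alpha> \<in> supercenter_pre n)
    \<and> (\<forall>c :: nat list \<Rightarrow> complex.
          fsum (\<lambda>\<alpha>. fscale (c \<alpha>) (Cel n \<alpha>)) (odd_partitions n) \<in> rel_ideal n
          \<longrightarrow> (\<forall>\<alpha>\<in>odd_partitions n. c \<alpha> = 0))
    \<and> (\<forall>x\<in>supercenter_pre n. \<exists>c :: nat list \<Rightarrow> complex.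
          fdiff x (fsum (\<lambda>\<alpha>. fscale (c \<alpha>) (Cel n \<alpha>)) (odd_partitions n)) \<in> rel_ideal n)"
proof (intro conjI ballI allI impI)
  show "Cel n \<alpha> \<in> supercenter_pre n" if "\<alpha> \<in> odd_partitions n" for \<alpha>
    using that by (rule Cel_in_supercenter)
  show "c \<alpha> = 0" if "fsum (\<lambda>\<alpha>. fscale (c \<alpha>) (Cel n \<alpha>)) (odd_partitions n) \<in> rel_ideal n"
    "\<alpha> \<in> odd_partitions n" for c \<alpha>
    using celop_independent[OF _ that(2)] rel_ideal_Phi[OF that(1)] by (simp add: Phi_Cel_combination)
  fix x assume "x \<in> supercenter_pre n"
  then obtain y where x: "is_poly n x" and y: "y \<in> szspan n" "fdiff x y \<in> rel_ideal n"
    by (auto simp: supercenter_pre_def)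
  have y': "is_poly n y" "Phi y \<in> celspan n" using szspan_in_celspan[OF y(1)] by auto
  have "Phi x = Phi y" using rel_ideal_Phi[OF y(2)] x y'(1) by (simp add: Phi_fdiff[of n])
  then obtain c where "Phi x = (\<Sum>\<alpha>\<in>odd_partitions n. of_c (c \<alpha>) * Phi (Cel n \<alpha>))"
    using y'(2) by (auto simp: celspan_def)
  \<comment> \<open>Equal operators come from congruent polynomials: here faithfulness of
    \<open>Phi\<close> is used, not only that it kills the ideal.\<close>
  then have "fdiff x (fsum (\<lambda>\<alpha>. fscale (c \<alpha>) (Cel n \<alpha>)) (odd_partitions n)) \<in> rel_ideal n"
    using x is_poly_Cel_combination[of n c "odd_partitions n"]
    by (simp add: rel_ideal_iff is_poly_fdiff Phi_fdiff[of n] Phi_Cel_combination)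
  then show "\<exists>c. fdiff x (fsum (\<lambda>\<alpha>. fscale (c \<alpha>) (Cel n \<alpha>)) (odd_partitions n)) \<in> rel_ideal n"
    by blast
qed

end
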